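(* Let $K\subseteq\mathbb{R}^2$ be a closed convex set with non-empty interior which is centrally symmetric and whose interior contains no point of $\mathbb{Z}^2$. Let $w:=w(K)$ be its lattice width and $A:=A(K)\in(0,\infty]$ its area. Then \begin{align*} 0&<w\le 2,\\ A&\le\infty &&\text{for } 0<w\le 1,\\ A&\le \frac{w^2}{2(w-1)} &&\text{for } 1<w\le 2,\\ A&\ge \tfrac12 w^2 &&\text{for } 0<w\le 2. \end{align*} Furthermore: (I) $w=2$ holds if and only if, up to a unimodular transformation, $K=\operatorname{conv}\{\pm(1,0),\pm(0,1)\}+(\frac12,\frac12)$. (II) Equality $A=\infty$ with $0<w\le1$ holds if and only if $K$ is unbounded and contained in a split. (III) For $1<w\le2$, equality $A=\frac{w^2}{2(w-1)}$ holds if and only if, up to a unimodular transformation, $K=\operatorname{conv}\{\pm(\frac w2,0),\pm(0,\frac{w}{2(w-1)})\}+(\frac12,\frac12)$. (IV) Equality $A=\frac12w^2$ holds if and only if, up to a unimodular transformation, $K$ is a translate of $\frac w2\operatorname{conv}\{\pm(1,\alpha),\pm(0,1)\}$ for some $0\le\alpha<1$ satisfying $\max\{1+\alpha,2-\alpha\}\ge w$.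
   Context: $K$ is centrally symmetric if $K=2c-K$ for some $c\in\mathbb{R}^2$. For $u\in\mathbb{R}^2$ the width function is $w(K,u):=\sup\{u^\top x:x\in K\}-\inf\{u^\top x:x\in K\}$ (possibly $+\infty$), and the lattice width is $w(K):=\min\{w(K,u):u\in\mathbb{Z}^2\setminus\{o\}\}$. A unimodular transformation is an affine bijection of $\mathbb{R}^2$ mapping $\mathbb{Z}^2$ onto $\mathbb{Z}^2$. A split is a set of the form $\{x\in\mathbb{R}^2: b\le a_1x_1+a_2x_2\le b+1\}$ with $a_1,a_2$ coprime integers and $b\in\mathbb{Z}$. *)

theory Defs
  imports "HOL-Analysis.Analysis"
begin

definition Z2 :: "(real \<times> real) set" where
  "Z2 = {x. fst x \<in> \<int> \<and> snd x \<in> \<int>}"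

definition centrally_symmetric :: "(real \<times> real) set \<Rightarrow> bool" where
  "centrally_symmetric K \<longleftrightarrow> (\<exists>c. K = (\<lambda>x. 2 *\<^sub>R c - x) ` K)"

definition width_fun :: "(real \<times> real) set \<Rightarrow> int \<times> int \<Rightarrow> ereal" where
  "width_fun K u =
     (SUP x\<in>K. ereal (of_int (fst u) * fst x + of_int (snd u) * snd x))
   - (INF x\<in>K. ereal (of_int (fst u) * fst x + of_int (snd u) * snd x))"

definition lattice_width :: "(real \<times> real) set \<Rightarrow> ereal" where
  "lattice_width K = (INF u\<in>(UNIV - {(0,0)}). width_fun K u)"

definition unimodular :: "(real \<times> real \<Rightarrow> real \<times> real) \<Rightarrow> bool" where
  "unimodular f \<longleftrightarrow> (\<exists>L b. linear L \<and> f = (\<lambda>x. L x + b)) \<and> bij f \<and> f ` Z2 = Z2"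

definition is_split :: "(real \<times> real) set \<Rightarrow> bool" where
  "is_split S \<longleftrightarrow> (\<exists>a1 a2 b :: int. coprime a1 a2 \<and>
     S = {x. of_int b \<le> of_int a1 * fst x + of_int a2 * snd x \<and>
             of_int a1 * fst x + of_int a2 * snd x \<le> of_int b + 1})"

definition area :: "(real \<times> real) set \<Rightarrow> ennreal" where
  "area K = emeasure lborel K"

end

theory Submission
  imports Defs
begin

text \<open>
  Translate the centre of symmetry to the origin, so that \<open>K = c + C\<close> with \<open>C = -C\<close>, and choose
  coordinates in which the lattice width is attained in direction \<open>(1,0)\<close>; write \<open>h = w/2\<close>.

  Lower bound: \<open>C\<close> touches the line \<open>x = h\<close> in a point \<open>p = (h, a h)\<close>. If \<open>a\<close> can be chosen to be an
  integer \<open>k\<close>, a point \<open>q\<close> of \<open>C\<close> at height at least \<open>h\<close> in direction \<open>(-k,1)\<close> spans with \<open>p\<close> a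
  parallelogram \<open>conv{\<plusminus>p,\<plusminus>q}\<close> of area at least \<open>2h\<^sup>2\<close>. If \<open>k < a < k+1\<close>, points \<open>q\<close>, \<open>r\<close> for the two
  directions \<open>(-k,1)\<close>, \<open>(-k-1,1)\<close> give either such a parallelogram or a hexagon
  \<open>conv{\<plusminus>p,\<plusminus>q,\<plusminus>r}\<close> of strictly larger area.

  Upper bound: the length of the vertical chords of \<open>C\<close> is an even concave function on \<open>[-h,h]\<close>. Some
  lattice line has distance \<open>s \<le> 1/2\<close> from the centre, and its chord has length at most \<open>1\<close> because \<open>K\<close>
  is lattice-free. A supporting line of the length function at \<open>s\<close> bounds the area by a tent integral.
  For \<open>h \<ge> 1\<close> this bound is \<open>2h\<close>, so together with the lower bound \<open>2h\<^sup>2\<close> it yields \<open>w \<le> 2\<close>.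

  An unbounded \<open>K\<close> is invariant under translation in some direction. By Kronecker's theorem this
  direction is rational, which puts \<open>K\<close> into a split.
\<close>

section \<open>Areas of polygons\<close>

definition det2 :: "real \<times> real \<Rightarrow> real \<times> real \<Rightarrow> real" where
  "det2 p q = fst p * snd q - snd p * fst q"

text \<open>Given by matrix entries, so that composition and inversion become ring identities and
  the integral maps \<open>int_lin\<close> are plain instances.\<close>

definition lin :: "real \<Rightarrow> real \<Rightarrow> real \<Rightarrow> real \<Rightarrow> real \<times> real \<Rightarrow> real \<times> real" where
  "lin a b c d x = (a * fst x + b * snd x, c * fst x + d * snd x)"

lemma linear_lin: "linear (lin a b c d)"
  by (rule linearI) (auto simp: lin_def algebra_simps)

lemma lin_lin: "lin a b c d (lin a' b' c' d' x) =
  lin (a * a' + b * c') (a * b' + b * d') (c * a' + d * c') (c * b' + d * d') x"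
  by (simp add: lin_def algebra_simps)

lemma lin_inverse:
  assumes "a * d - b * c \<noteq> 0"
  defines "D \<equiv> a * d - b * c"
  shows "lin (d/D) (-b/D) (-c/D) (a/D) (lin a b c d x) = x"
    and "lin a b c d (lin (d/D) (-b/D) (-c/D) (a/D) x) = x"
proof -
  have "D \<noteq> 0" using assms by simp
  then show "lin (d/D) (-b/D) (-c/D) (a/D) (lin a b c d x) = x"
    and "lin a b c d (lin (d/D) (-b/D) (-c/D) (a/D) x) = x"
    unfolding lin_lin by (auto simp: lin_def prod_eq_iff field_simps; simp add: D_def algebra_simps)+
qed

lemma continuous_on_lin [continuous_intros]: "continuous_on S (lin a b c d)"
  by (simp add: linear_continuous_on linear_conv_bounded_linear[symmetric] linear_lin)

section \<open>Lebesgue measure of the plane under linear maps and translations\<close>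

lemma lborel_eq_distr_vec2: "lborel = distr lborel borel (\<lambda>v::real^2. (v$1, v$2))"
proof (rule lborel_eqI)
  fix l u :: "real \<times> real"
  assume "\<And>b. b \<in> Basis \<Longrightarrow> l \<bullet> b \<le> u \<bullet> b"
  from this[of "(1,0)"] this[of "(0,1)"] have le: "fst l \<le> fst u" "snd l \<le> snd u"
    by (auto simp: Basis_prod_def inner_prod_def)
  let ?l = "vector [fst l, snd l] :: real^2" and ?u = "vector [fst u, snd u] :: real^2"
  have 1: "(\<lambda>v::real^2. (v$1, v$2)) -` box l u = box ?l ?u"
    by (auto simp: box_def mem_box Basis_prod_def inner_prod_def Basis_vec_def inner_axis forall_2 vector_2)
  have 2: "(\<Prod>b\<in>Basis. (u - l) \<bullet> b) = (fst u - fst l) * (snd u - snd l)"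
  proof -
    have B: "(Basis::(real \<times> real) set) = {(1,0), (0,1)}" by (auto simp: Basis_prod_def)
    show ?thesis unfolding B by (simp add: inner_prod_def)
  qed
  have 3: "(\<Prod>b\<in>Basis. (?u - ?l) \<bullet> b) = (fst u - fst l) * (snd u - snd l)"
  proof -
    have B: "(Basis::(real^2) set) = {axis 1 1, axis 2 1}"
      by (auto simp: Basis_vec_def) (metis exhaust_2)
    have "axis 1 1 \<noteq> (axis 2 1 :: real^2)" by (simp add: axis_eq_axis)
    then show ?thesis unfolding B by (simp add: inner_axis vector_2)
  qed
  have lu: "\<forall>i. ?l $ i \<le> ?u $ i" using le by (simp add: forall_2 vector_2)
  have "emeasure lborel (box ?l ?u) = ennreal (\<Prod>b\<in>Basis. (?u - ?l) \<bullet> b)"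
    by (rule emeasure_lborel_box) (use lu in \<open>auto simp: Basis_vec_def inner_axis\<close>)
  then show "emeasure (distr lborel borel (\<lambda>v::real^2. (v$1, v$2))) (box l u) = (\<Prod>b\<in>Basis. (u - l) \<bullet> b)"
    by (subst emeasure_distr) (auto simp: 1 2 3)
qed auto

text \<open>The determinant formula is applied on \<open>real^2\<close>: \<open>S\<close> is moved
  there along \<open>lborel_eq_distr_vec2\<close> and the result is moved back. Boundedness makes
  the measure finite, hence \<open>lmeasurable\<close>.\<close>

lemma emeasure_lin_image:
  assumes S: "S \<in> sets borel" and bd: "bounded S" and D: "a * d - b * c \<noteq> 0"
  shows "emeasure lborel (lin a b c d ` S) = ennreal \<bar>a * d - b * c\<bar> * emeasure lborel S"
proof -
  let ?f = "\<lambda>v::real^2. (v$1, v$2)" and ?g = "\<lambda>p. vector [fst p, snd p] :: real^2"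
  let ?L = "\<lambda>v::real^2. vector [a * v$1 + b * v$2, c * v$1 + d * v$2] :: real^2"
  let ?V = "?f -` S"
  have fm: "?f \<in> borel_measurable borel" by simp
  have Vs: "?V \<in> sets borel" using measurable_sets[OF fm S] by simp
  have em: "emeasure lborel X = emeasure lborel (?f -` X)" if "X \<in> sets borel" for X :: "(real \<times> real) set"
    by (subst lborel_eq_distr_vec2, subst emeasure_distr) (use that in auto)
  have finV: "emeasure lborel ?V < \<infinity>" using em[OF S] emeasure_bounded_finite[OF bd] by simp
  have VL: "?V \<in> lmeasurable" using Vs finV by (intro fmeasurableI) auto
  have lL: "linear ?L"
    by (rule linearI) (auto simp: vec_eq_iff forall_2 vector_2 algebra_simps)
  have det: "det (matrix ?L) = a * d - b * c"
    by (simp add: det_2 matrix_def axis_def vector_2)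
  have LS: "lin a b c d ` S \<in> sets borel"
  proof -
    obtain a' b' c' d' where inv: "\<And>x. lin a' b' c' d' (lin a b c d x) = x" "\<And>x. lin a b c d (lin a' b' c' d' x) = x"
      using lin_inverse[OF D] by metis
    have "lin a b c d ` S = lin a' b' c' d' -` S"
      using inv by (auto simp: image_iff) metis
    moreover have "lin a' b' c' d' \<in> borel_measurable borel"
      by (intro borel_measurable_continuous_onI continuous_on_lin)
    ultimately show ?thesis using measurable_sets[of "lin a' b' c' d'" borel borel S] S by simp
  qed
  have im: "?f -` (lin a b c d ` S) = ?L ` ?V"
  proof (intro equalityI subsetI)
    fix v assume "v \<in> ?f -` (lin a b c d ` S)"
    then obtain p where p: "p \<in> S" "?f v = lin a b c d p" by auto
    then have "v = ?L (?g p)" by (simp add: vec_eq_iff forall_2 vector_2 lin_def)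
    moreover have "?g p \<in> ?V" using p by (simp add: vector_2)
    ultimately show "v \<in> ?L ` ?V" by blast
  next
    fix v assume "v \<in> ?L ` ?V"
    then obtain x where "?f x \<in> S" "v = ?L x" by auto
    then have "?f v = lin a b c d (?f x)" by (simp add: vector_2 lin_def)
    then show "v \<in> ?f -` (lin a b c d ` S)" using \<open>?f x \<in> S\<close> by auto
  qed
  have LVs: "?L ` ?V \<in> sets borel" using measurable_sets[OF fm LS] im by simp
  have mL: "?L ` ?V \<in> lmeasurable" and ms: "measure lebesgue (?L ` ?V) = \<bar>a * d - b * c\<bar> * measure lebesgue ?V"
    using measurable_linear_image[OF lL VL] measure_linear_image[OF lL VL] det by auto
  have "emeasure lborel (lin a b c d ` S) = emeasure lebesgue (?L ` ?V)"
    using em[OF LS] im LVs by simp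
  also have "\<dots> = ennreal (\<bar>a * d - b * c\<bar> * measure lebesgue ?V)"
    using emeasure_eq_measure2[OF mL] ms by simp
  also have "\<dots> = ennreal \<bar>a * d - b * c\<bar> * emeasure lebesgue ?V"
    using emeasure_eq_measure2[OF VL] by (simp add: ennreal_mult)
  also have "emeasure lebesgue ?V = emeasure lborel S"
    using em[OF S] Vs by simp
  finally show ?thesis .
qed

lemma emeasure_lborel_translate:
  fixes S :: "'a::euclidean_space set"
  assumes "S \<in> sets borel"
  shows "emeasure lborel ((+) t ` S) = emeasure lborel S"
proof -
  have "emeasure lborel S = emeasure (distr lborel borel ((+) (- t))) S"
    by (simp add: lborel_distr_plus)
  also have "\<dots> = emeasure lborel ((+) (-t) -` S)" by (subst emeasure_distr) (use assms in auto)
  also have "(+) (-t) -` S = (+) t ` S"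
    by (auto simp: image_iff) (metis add.commute add_diff_cancel_left' diff_add_cancel uminus_add_conv_diff)
  finally show ?thesis by simp
qed

lemma emeasure_lborel_slices:
  fixes X :: "(real \<times> real) set"
  assumes "X \<in> sets borel"
  shows "emeasure lborel X = (\<integral>\<^sup>+x. emeasure lborel {y. (x, y) \<in> X} \<partial>lborel)"
proof -
  have "emeasure (lborel \<Otimes>\<^sub>M lborel) X = (\<integral>\<^sup>+x. emeasure lborel (Pair x -` X) \<partial>(lborel::real measure))"
    by (rule lborel.emeasure_pair_measure_alt) (metis assms lborel_prod sets_lborel)
  then show ?thesis by (simp add: lborel_prod vimage_def)
qed

text \<open>The hull is the image of the 1-norm unit ball under the linear map taking the unit
  vectors to \<open>p\<close> and \<open>q\<close>. Membership, interior points and areas of crosses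
  are computed in these coordinates.\<close>

lemma convex_hull_cross:
  fixes p q :: "'a::real_vector"
  shows "convex hull {p, -p, q, -q} = {\<alpha> *\<^sub>R p + \<beta> *\<^sub>R q | \<alpha> \<beta>. \<bar>\<alpha>\<bar> + \<bar>\<beta>\<bar> \<le> 1}" (is "?L = ?R")
proof
  have "convex ?R"
  proof (rule convexI)
    fix x y u v :: real and a b assume "a \<in> ?R" "b \<in> ?R" "0 \<le> u" "0 \<le> v" "u + v = 1"
    then obtain \<alpha> \<beta> \<gamma> \<delta> where *: "a = \<alpha> *\<^sub>R p + \<beta> *\<^sub>R q" "\<bar>\<alpha>\<bar> + \<bar>\<beta>\<bar> \<le> 1" "b = \<gamma> *\<^sub>R p + \<delta> *\<^sub>R q" "\<bar>\<gamma>\<bar> + \<bar>\<delta>\<bar> \<le> 1"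
      by blast
    have "u *\<^sub>R a + v *\<^sub>R b = (u * \<alpha> + v * \<gamma>) *\<^sub>R p + (u * \<beta> + v * \<delta>) *\<^sub>R q"
      by (simp add: * algebra_simps)
    moreover have "\<bar>u * \<alpha> + v * \<gamma>\<bar> + \<bar>u * \<beta> + v * \<delta>\<bar> \<le> 1"
    proof -
      have "\<bar>u * \<alpha> + v * \<gamma>\<bar> + \<bar>u * \<beta> + v * \<delta>\<bar> \<le> u * (\<bar>\<alpha>\<bar> + \<bar>\<beta>\<bar>) + v * (\<bar>\<gamma>\<bar> + \<bar>\<delta>\<bar>)"
        using \<open>0 \<le> u\<close> \<open>0 \<le> v\<close> abs_triangle_ineq[of "u * \<alpha>" "v * \<gamma>"] abs_triangle_ineq[of "u * \<beta>" "v * \<delta>"]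
        by (simp add: abs_mult algebra_simps)
      also have "\<dots> \<le> u * 1 + v * 1" using * \<open>0 \<le> u\<close> \<open>0 \<le> v\<close> by (intro add_mono mult_left_mono) auto
      finally show ?thesis using \<open>u + v = 1\<close> by simp
    qed
    ultimately show "u *\<^sub>R a + v *\<^sub>R b \<in> ?R" by blast
  qed
  moreover have "{p, -p, q, -q} \<subseteq> ?R"
  proof -
    have "p = 1 *\<^sub>R p + 0 *\<^sub>R q" "-p = (-1) *\<^sub>R p + 0 *\<^sub>R q" "q = 0 *\<^sub>R p + 1 *\<^sub>R q" "-q = 0 *\<^sub>R p + (-1) *\<^sub>R q"
      by auto
    then show ?thesis by fastforce
  qed
  ultimately show "?L \<subseteq> ?R" by (rule hull_minimal[rotated])
  show "?R \<subseteq> ?L"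
  proof
    fix x assume "x \<in> ?R"
    then obtain \<alpha> \<beta> where x: "x = \<alpha> *\<^sub>R p + \<beta> *\<^sub>R q" "\<bar>\<alpha>\<bar> + \<bar>\<beta>\<bar> \<le> 1" by blast
    let ?s = "if \<alpha> \<ge> 0 then p else -p" and ?t = "if \<beta> \<ge> 0 then q else -q"
    have c: "convex ?L" by simp
    have mem: "?s \<in> ?L" "?t \<in> ?L" "p \<in> ?L" "-p \<in> ?L" by (auto intro: hull_inc)
    have "0 = (1/2) *\<^sub>R p + (1/2) *\<^sub>R (-p)" by simp
    then have "0 \<in> ?L" using convexD[OF c mem(3,4), of "1/2" "1/2"] by simp
    have "x = \<bar>\<alpha>\<bar> *\<^sub>R ?s + \<bar>\<beta>\<bar> *\<^sub>R ?t + (1 - \<bar>\<alpha>\<bar> - \<bar>\<beta>\<bar>) *\<^sub>R 0" using x by auto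
    moreover have "\<dots> \<in> ?L"
    proof -
      have "convex hull {?s, ?t, 0} \<subseteq> ?L" by (rule hull_minimal) (use mem \<open>0 \<in> ?L\<close> in auto)
      moreover have "\<bar>\<alpha>\<bar> *\<^sub>R ?s + \<bar>\<beta>\<bar> *\<^sub>R ?t + (1 - \<bar>\<alpha>\<bar> - \<bar>\<beta>\<bar>) *\<^sub>R 0 \<in> convex hull {?s, ?t, 0}"
        unfolding convex_hull_3 using x(2) by (intro CollectI exI[of _ "\<bar>\<alpha>\<bar>"] exI[of _ "\<bar>\<beta>\<bar>"] exI[of _ "1 - \<bar>\<alpha>\<bar> - \<bar>\<beta>\<bar>"]) auto
      ultimately show ?thesis by blast
    qed
    ultimately show "x \<in> ?L" by simp
  qed
qed

section \<open>Areas by integration of slice lengths\<close>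

lemma area_le_integral:
  fixes X :: "(real \<times> real) set"
  assumes X: "X \<in> sets borel" and sub: "\<And>x y. (x, y) \<in> X \<Longrightarrow> a \<le> x \<and> x \<le> b"
    and le: "\<And>x. a \<le> x \<Longrightarrow> x \<le> b \<Longrightarrow> emeasure lborel {y. (x, y) \<in> X} \<le> ennreal (B x)"
    and nn: "\<And>x. a \<le> x \<Longrightarrow> x \<le> b \<Longrightarrow> 0 \<le> B x" and I: "(B has_integral I) {a..b}"
  shows "emeasure lborel X \<le> ennreal I"
proof -
  have "emeasure lborel X = (\<integral>\<^sup>+x. emeasure lborel {y. (x, y) \<in> X} \<partial>lborel)"
    by (rule emeasure_lborel_slices[OF X])
  also have "\<dots> \<le> (\<integral>\<^sup>+x. ennreal (B x) * indicator {a..b} x \<partial>lborel)"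
  proof (rule nn_integral_mono)
    fix x
    have "{y. (x, y) \<in> X} = {}" if "x \<notin> {a..b}" using sub that by auto
    then show "emeasure lborel {y. (x, y) \<in> X} \<le> ennreal (B x) * indicator {a..b} x"
      using le[of x] by (cases "x \<in> {a..b}") auto
  qed
  also have "\<dots> = ennreal I" by (rule nn_integral_has_integral_lebesgue') (use nn I in auto)
  finally show ?thesis .
qed

lemma area_eq_integral:
  fixes X :: "(real \<times> real) set"
  assumes X: "X \<in> sets borel" and sub: "\<And>x y. (x, y) \<in> X \<Longrightarrow> a \<le> x \<and> x \<le> b"
    and eq: "\<And>x. a \<le> x \<Longrightarrow> x \<le> b \<Longrightarrow> emeasure lborel {y. (x, y) \<in> X} = ennreal (B x)"
    and nn: "\<And>x. a \<le> x \<Longrightarrow> x \<le> b \<Longrightarrow> 0 \<le> B x" and I: "(B has_integral I) {a..b}"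
  shows "emeasure lborel X = ennreal I"
proof -
  have "emeasure lborel X = (\<integral>\<^sup>+x. emeasure lborel {y. (x, y) \<in> X} \<partial>lborel)"
    by (rule emeasure_lborel_slices[OF X])
  also have "\<dots> = (\<integral>\<^sup>+x. ennreal (B x) * indicator {a..b} x \<partial>lborel)"
  proof (rule nn_integral_cong)
    fix x
    have "{y. (x, y) \<in> X} = {}" if "x \<notin> {a..b}" using sub that by auto
    then show "emeasure lborel {y. (x, y) \<in> X} = ennreal (B x) * indicator {a..b} x"
      using eq[of x] by (cases "x \<in> {a..b}") auto
  qed
  also have "\<dots> = ennreal I" by (rule nn_integral_has_integral_lebesgue') (use nn I in auto)
  finally show ?thesis .
qed

lemma has_integral_affine:
  fixes a b k l :: real
  assumes "a \<le> b"
  shows "((\<lambda>x. k + l * x) has_integral (k * (b - a) + l * (b\<^sup>2 - a\<^sup>2) / 2)) {a..b}"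
proof -
  have "((\<lambda>x. k + l * x) has_integral ((k * b + l * b\<^sup>2 / 2) - (k * a + l * a\<^sup>2 / 2))) {a..b}"
    by (rule fundamental_theorem_of_calculus[OF assms])
      (auto intro!: derivative_eq_intros simp flip: has_real_derivative_iff_has_vector_derivative)
  then show ?thesis by (simp add: algebra_simps diff_divide_distrib)
qed

text \<open>The tent appears twice: as the slice length of the unit cross, and as the majorant of
  the chord length in the upper bound.\<close>

lemma has_integral_tent:
  fixes h k m :: real
  assumes "0 \<le> h"
  shows "((\<lambda>x. k - m * \<bar>x\<bar>) has_integral (2 * h * k - m * h\<^sup>2)) {-h..h}"
proof -
  have "((\<lambda>x. k - m * \<bar>x\<bar>) has_integral (h * k - m * h\<^sup>2 / 2)) {-h..0}"
    by (rule has_integral_eq[OF _ has_integral_eq_rhs[OF has_integral_affine[of "-h" 0 k m]]]) (use assms in auto)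
  moreover have "((\<lambda>x. k - m * \<bar>x\<bar>) has_integral (h * k - m * h\<^sup>2 / 2)) {0..h}"
    by (rule has_integral_eq[OF _ has_integral_eq_rhs[OF has_integral_affine[of 0 h k "-m"]]]) (use assms in auto)
  ultimately have "((\<lambda>x. k - m * \<bar>x\<bar>) has_integral ((h * k - m * h\<^sup>2 / 2) + (h * k - m * h\<^sup>2 / 2))) {-h..h}"
    by (rule has_integral_combine[rotated 2]) (use assms in auto)
  then show ?thesis by (simp add: algebra_simps)
qed

section \<open>Areas of crosses, triangles and hexagons\<close>

lemma area_unit_cross: "emeasure lborel {x::real\<times>real. \<bar>fst x\<bar> + \<bar>snd x\<bar> \<le> 1} = 2"
proof -
  have "closed {x::real\<times>real. \<bar>fst x\<bar> + \<bar>snd x\<bar> \<le> 1}" by (intro closed_Collect_le continuous_intros)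
  moreover have "{y. \<bar>x\<bar> + \<bar>y\<bar> \<le> 1} = {-(1-\<bar>x\<bar>)..1-\<bar>x\<bar>}" for x :: real by auto
  ultimately have "emeasure lborel {x::real\<times>real. \<bar>fst x\<bar> + \<bar>snd x\<bar> \<le> 1} = ennreal (2 * 1 * 2 - 2 * 1\<^sup>2)"
    by (intro area_eq_integral[OF _ _ _ _ has_integral_tent]) auto
  then show ?thesis by simp
qed

lemma area_unit_triangle: "emeasure lborel {x::real\<times>real. 0 < fst x \<and> 0 < snd x \<and> fst x + snd x < 1} = ennreal (1/2)"
proof -
  have o: "open {x::real\<times>real. 0 < fst x \<and> 0 < snd x \<and> fst x + snd x < 1}"
    by (intro open_Collect_conj open_Collect_less continuous_intros)
  have *: "{y. 0 < x \<and> 0 < y \<and> x + y < 1} = (if 0 < x then {0<..<1 - x} else {})" for x :: real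
    by auto
  have "emeasure lborel {x::real\<times>real. 0 < fst x \<and> 0 < snd x \<and> fst x + snd x < 1}
    = (\<integral>\<^sup>+x. emeasure lborel {y::real. 0 < x \<and> 0 < y \<and> x + y < 1} \<partial>lborel)"
    using emeasure_lborel_slices[OF borel_open[OF o]] by simp
  also have "\<dots> = (\<integral>\<^sup>+x. ennreal (1 + (-1) * x) * indicator {0..1} x \<partial>lborel)"
  \<comment> \<open>The two integrands differ at \<open>x = 0\<close>, where the slice is empty but
    the affine function is 1; so they agree only almost everywhere.\<close>
  proof (rule nn_integral_cong_AE, rule AE_I[where N="{0}"], rule subsetI)
    fix x :: real
    assume x: "x \<in> {x \<in> space lborel. \<not> emeasure lborel {y::real. 0 < x \<and> 0 < y \<and> x + y < 1}
       = ennreal (1 + (-1) * x) * indicator {0..1} x}"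
    have "emeasure lborel {y::real. 0 < x \<and> 0 < y \<and> x + y < 1} = ennreal (1 + (-1) * x) * indicator {0..1} x" if "x \<noteq> 0"
      using that unfolding * by (cases "x < 0"; cases "x \<le> 1") auto
    then show "x \<in> {0}" using x by blast
  qed auto
  also have "\<dots> = ennreal (1 * (1 - 0) + (-1) * (1\<^sup>2 - 0\<^sup>2) / 2)"
    by (intro nn_integral_has_integral_lebesgue' has_integral_affine) auto
  finally show ?thesis by simp
qed

lemma cross_eq_lin_image:
  "convex hull {p, -p, q, -q} = lin (fst p) (fst q) (snd p) (snd q) ` {x. \<bar>fst x\<bar> + \<bar>snd x\<bar> \<le> 1}"
proof -
  have "lin (fst p) (fst q) (snd p) (snd q) x = fst x *\<^sub>R p + snd x *\<^sub>R q" for x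
    by (simp add: lin_def prod_eq_iff)
  then have L: "lin (fst p) (fst q) (snd p) (snd q) = (\<lambda>x. fst x *\<^sub>R p + snd x *\<^sub>R q)" by blast
  show ?thesis
  proof (intro equalityI subsetI)
    fix x assume "x \<in> convex hull {p, -p, q, -q}"
    then obtain \<alpha> \<beta> where "x = \<alpha> *\<^sub>R p + \<beta> *\<^sub>R q" "\<bar>\<alpha>\<bar> + \<bar>\<beta>\<bar> \<le> 1"
      unfolding convex_hull_cross by blast
    then show "x \<in> lin (fst p) (fst q) (snd p) (snd q) ` {x. \<bar>fst x\<bar> + \<bar>snd x\<bar> \<le> 1}"
      unfolding L by (intro image_eqI[of _ _ "(\<alpha>, \<beta>)"]) auto
  next
    fix x assume "x \<in> lin (fst p) (fst q) (snd p) (snd q) ` {x. \<bar>fst x\<bar> + \<bar>snd x\<bar> \<le> 1}"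
    then show "x \<in> convex hull {p, -p, q, -q}" unfolding L convex_hull_cross by blast
  qed
qed

lemma bounded_unit_cross: "bounded {x::real\<times>real. \<bar>fst x\<bar> + \<bar>snd x\<bar> \<le> 1}"
proof -
  have "norm x \<le> 1" if "\<bar>fst x\<bar> + \<bar>snd x\<bar> \<le> 1" for x :: "real\<times>real"
    using norm_Pair_le[of "fst x" "snd x"] that by simp
  then show ?thesis unfolding bounded_iff by blast
qed

lemma area_cross:
  assumes "det2 p q \<noteq> 0"
  shows "emeasure lborel (convex hull {p, -p, q, -q}) = ennreal (2 * \<bar>det2 p q\<bar>)"
proof -
  have "closed {x::real\<times>real. \<bar>fst x\<bar> + \<bar>snd x\<bar> \<le> 1}" by (intro closed_Collect_le continuous_intros)
  then have "emeasure lborel (convex hull {p, -p, q, -q}) = ennreal \<bar>fst p * snd q - fst q * snd p\<bar> * 2"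
    unfolding cross_eq_lin_image
    by (subst emeasure_lin_image) (use assms in \<open>auto simp: bounded_unit_cross area_unit_cross det2_def mult.commute\<close>)
  also have "\<dots> = ennreal (2 * \<bar>det2 p q\<bar>)"
    by (simp add: det2_def ennreal_mult mult.commute)
  finally show ?thesis .
qed

text \<open>The third vertex is the origin. The boundary is left out so that triangles sharing an
  edge are disjoint and their areas simply add up.\<close>

definition open_triangle :: "real \<times> real \<Rightarrow> real \<times> real \<Rightarrow> (real \<times> real) set" where
  "open_triangle p q = {\<alpha> *\<^sub>R p + \<beta> *\<^sub>R q | \<alpha> \<beta>. 0 < \<alpha> \<and> 0 < \<beta> \<and> \<alpha> + \<beta> < 1}"

lemma
  assumes D: "det2 p q \<noteq> 0"
  shows open_open_triangle: "open (open_triangle p q)"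
    and area_open_triangle: "emeasure lborel (open_triangle p q) = ennreal (\<bar>det2 p q\<bar> / 2)"
proof -
  let ?T = "{x::real\<times>real. 0 < fst x \<and> 0 < snd x \<and> fst x + snd x < 1}"
  let ?L = "lin (fst p) (fst q) (snd p) (snd q)"
  have L: "?L x = fst x *\<^sub>R p + snd x *\<^sub>R q" for x
    by (simp add: lin_def prod_eq_iff)
  have im: "open_triangle p q = ?L ` ?T"
  proof (intro equalityI subsetI)
    fix x assume "x \<in> open_triangle p q"
    then obtain \<alpha> \<beta> where "x = \<alpha> *\<^sub>R p + \<beta> *\<^sub>R q" "0 < \<alpha>" "0 < \<beta>" "\<alpha> + \<beta> < 1"
      unfolding open_triangle_def by blast
    then have "x = ?L (\<alpha>, \<beta>)" "(\<alpha>, \<beta>) \<in> ?T" by (auto simp: L)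
    then show "x \<in> ?L ` ?T" by blast
  next
    fix x assume "x \<in> ?L ` ?T"
    then obtain y where "x = fst y *\<^sub>R p + snd y *\<^sub>R q" "y \<in> ?T" using L by auto
    then show "x \<in> open_triangle p q" unfolding open_triangle_def by blast
  qed
  have o: "open ?T" by (intro open_Collect_conj open_Collect_less continuous_intros)
  have D': "fst p * snd q - fst q * snd p \<noteq> 0" using D by (simp add: det2_def mult.commute)
  have "surj ?L" by (rule surjI, rule lin_inverse(2)[OF D'])
  then show "open (open_triangle p q)" unfolding im
    using open_surjective_linear_image[OF o linear_lin] by blast
  have "bounded ?T" by (rule bounded_subset[OF bounded_unit_cross]) auto
  then have "emeasure lborel (open_triangle p q) = ennreal \<bar>fst p * snd q - fst q * snd p\<bar> * ennreal (1/2)"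
    unfolding im area_unit_triangle[symmetric] using o D' by (subst emeasure_lin_image) auto
  also have "\<dots> = ennreal (\<bar>fst p * snd q - fst q * snd p\<bar> * (1/2))"
    by (rule ennreal_mult[symmetric]) auto
  finally show "emeasure lborel (open_triangle p q) = ennreal (\<bar>det2 p q\<bar> / 2)"
    by (simp add: det2_def mult.commute)
qed

lemma open_triangle_subset:
  assumes "convex C" "0 \<in> C" "p \<in> C" "q \<in> C"
  shows "open_triangle p q \<subseteq> C"
proof
  fix x assume "x \<in> open_triangle p q"
  then obtain a b where x: "x = a *\<^sub>R p + b *\<^sub>R q" "0 < a" "0 < b" "a + b < 1"
    unfolding open_triangle_def by blast
  have "x \<in> convex hull {p, q, 0}"
    unfolding convex_hull_3 using x by (intro CollectI exI[of _ a] exI[of _ b] exI[of _ "1 - a - b"]) auto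
  moreover have "convex hull {p, q, 0} \<subseteq> C" by (rule hull_minimal) (use assms in auto)
  ultimately show "x \<in> C" by blast
qed

text \<open>The sign conditions put \<open>p\<close>, \<open>q\<close>, \<open>r\<close>,
  \<open>-p\<close> in counterclockwise order. So the hexagon spanned by them and their negatives
  contains six disjoint open triangles with apex 0, in three antipodal pairs of areas
  \<open>det2 p q / 2\<close>, \<open>det2 q r / 2\<close> and
  \<open>det2 r (-p) / 2 = det2 p r / 2\<close>.\<close>

lemma hexagon_area_le:
  assumes C: "convex C" "C \<in> sets borel" "\<And>x. x \<in> C \<Longrightarrow> -x \<in> C"
    and pqr: "p \<in> C" "q \<in> C" "r \<in> C" and pos: "det2 p q > 0" "det2 q r > 0" "det2 p r > 0"
  shows "ennreal (det2 p q + det2 q r + det2 p r) \<le> emeasure lborel C"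
proof -
  have "0 \<in> C" using convexD[OF C(1) pqr(1) C(3)[OF pqr(1)], of "1/2" "1/2"] by simp
  have det_simps: "det2 (-x) y = - det2 x y" "det2 x (-y) = - det2 x y"
    "det2 x (s *\<^sub>R y + t *\<^sub>R z) = s * det2 x y + t * det2 x z" "det2 x y = - det2 y x" for x y z s t
    by (auto simp: det2_def algebra_simps)
  have dets: "det2 r (-p) > 0" "det2 (-p) (-q) > 0" "det2 (-q) (-r) > 0" "det2 (-r) p > 0"
    using pos by (auto simp: det2_def algebra_simps)
  have tri: "det2 u x > 0 \<and> det2 v x < 0 \<and> (\<exists>a b. 0 < a \<and> 0 < b \<and> x = a *\<^sub>R u + b *\<^sub>R v)" if "x \<in> open_triangle u v" "det2 u v > 0" for u v x
  proof -
    obtain a b where ab: "x = a *\<^sub>R u + b *\<^sub>R v" "0 < a" "0 < b"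
      using \<open>x \<in> open_triangle u v\<close> unfolding open_triangle_def by blast
    have "det2 u x = b * det2 u v" "det2 v x = - (a * det2 u v)"
      by (auto simp: ab(1) det2_def algebra_simps)
    then show ?thesis using ab that(2) by auto
  qed
  define S where "S = open_triangle p q \<union> open_triangle q r \<union> open_triangle r (-p)"
  define S' where "S' = open_triangle (-p) (-q) \<union> open_triangle (-q) (-r) \<union> open_triangle (-r) p"
  \<comment> \<open>The sign of \<open>det2 p x\<close> tells on which side of the line through 0
    and \<open>p\<close> a point lies; it separates the three triangles of \<open>S\<close> from
    those of \<open>S'\<close>.\<close>
  have pS: "det2 p x > 0" if "x \<in> S" for x
  proof -
    have "det2 p x > 0" if t: "x \<in> open_triangle q r"
    proof -
      obtain a b where "0 < a" "0 < b" "x = a *\<^sub>R q + b *\<^sub>R r" using tri[OF t pos(2)] by blast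
      then show ?thesis using pos by (simp add: det_simps(3) add_pos_pos)
    qed
    then show ?thesis using that tri[of x p q] tri[of x r "-p"] pos dets
      unfolding S_def by (auto simp: det2_def)
  qed
  have pS': "det2 p x < 0" if "x \<in> S'" for x
  proof -
    have "det2 p x < 0" if t: "x \<in> open_triangle (-q) (-r)"
    proof -
      obtain a b where "0 < a" "0 < b" and x: "x = a *\<^sub>R (-q) + b *\<^sub>R (-r)" using tri[OF t dets(3)] by blast
      have "det2 p x = - (a * det2 p q + b * det2 p r)" unfolding x by (simp add: det2_def algebra_simps)
      moreover have "0 < a * det2 p q + b * det2 p r" using pos \<open>0 < a\<close> \<open>0 < b\<close> by (simp add: add_pos_pos)
      ultimately show ?thesis by linarith
    qed
    then show ?thesis using that tri[of x "-p" "-q"] tri[of x "-r" "p"] pos dets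
      unfolding S'_def by (auto simp: det2_def)
  qed
  \<comment> \<open>Within one half-plane the lines through \<open>q\<close> and through
    \<open>r\<close> separate the triangles in the same way.\<close>
  have d1: "open_triangle p q \<inter> open_triangle q r = {}"
    using tri[of _ p q] tri[of _ q r] pos by force
  have d2: "(open_triangle p q \<union> open_triangle q r) \<inter> open_triangle r (-p) = {}"
  proof -
    have "det2 q x > 0" if t: "x \<in> open_triangle r (-p)" for x
    proof -
      obtain a b where "0 < a" "0 < b" and x: "x = a *\<^sub>R r + b *\<^sub>R (-p)" using tri[OF t dets(1)] by blast
      have "det2 q x = a * det2 q r + b * det2 p q" unfolding x by (simp add: det2_def algebra_simps)
      then show ?thesis using pos \<open>0 < a\<close> \<open>0 < b\<close> by (simp add: add_pos_pos)
    qed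
    then show ?thesis using tri[of _ p q] tri[of _ q r] tri[of _ r "-p"] pos dets by force
  qed
  have d1': "open_triangle (-p) (-q) \<inter> open_triangle (-q) (-r) = {}"
    using tri[of _ "-p" "-q"] tri[of _ "-q" "-r"] dets by force
  have d2': "(open_triangle (-p) (-q) \<union> open_triangle (-q) (-r)) \<inter> open_triangle (-r) p = {}"
  proof -
    have "det2 (-q) x > 0" if t: "x \<in> open_triangle (-r) p" for x
    proof -
      obtain a b where "0 < a" "0 < b" and x: "x = a *\<^sub>R (-r) + b *\<^sub>R p" using tri[OF t dets(4)] by blast
      have "det2 (-q) x = a * det2 q r + b * det2 p q" unfolding x by (simp add: det2_def algebra_simps)
      then show ?thesis using pos \<open>0 < a\<close> \<open>0 < b\<close> by (simp add: add_pos_pos)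
    qed
    then show ?thesis using tri[of _ "-p" "-q"] tri[of _ "-q" "-r"] tri[of _ "-r" p] pos dets by force
  qed
  have op: "open_triangle p q \<in> sets lborel" "open_triangle q r \<in> sets lborel" "open_triangle r (-p) \<in> sets lborel"
    "open_triangle (-p) (-q) \<in> sets lborel" "open_triangle (-q) (-r) \<in> sets lborel" "open_triangle (-r) p \<in> sets lborel"
    using pos dets by (auto intro!: borel_open open_open_triangle)
  have aS: "emeasure lborel S = ennreal ((det2 p q + det2 q r + det2 p r) / 2)"
  proof -
    have "emeasure lborel S = ennreal (det2 p q / 2) + ennreal (det2 q r / 2) + ennreal (det2 p r / 2)"
      unfolding S_def using pos dets
      by (subst plus_emeasure[symmetric, OF _ _ d2] plus_emeasure[symmetric, OF _ _ d1]; (use op in auto)?)+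
        (auto simp: area_open_triangle det_simps(2) det_simps(4)[of r p])
    then show ?thesis using pos by (simp flip: ennreal_plus add: add_divide_distrib)
  qed
  have aS': "emeasure lborel S' = ennreal ((det2 p q + det2 q r + det2 p r) / 2)"
  proof -
    have "emeasure lborel S' = ennreal (det2 p q / 2) + ennreal (det2 q r / 2) + ennreal (det2 p r / 2)"
      unfolding S'_def using pos dets
      by (subst plus_emeasure[symmetric, OF _ _ d2'] plus_emeasure[symmetric, OF _ _ d1']; (use op in auto)?)+
        (auto simp: area_open_triangle det_simps(1,2) det_simps(4)[of r p])
    then show ?thesis using pos by (simp flip: ennreal_plus add: add_divide_distrib)
  qed
  have "emeasure lborel (S \<union> S') = ennreal (det2 p q + det2 q r + det2 p r)"
  proof -
    have "S \<inter> S' = {}" using pS pS' by force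
    then have "emeasure lborel (S \<union> S') = emeasure lborel S + emeasure lborel S'"
      using op by (intro plus_emeasure[symmetric]) (auto simp: S_def S'_def)
    then show ?thesis using aS aS' pos by (simp flip: ennreal_plus)
  qed
  moreover have "S \<union> S' \<subseteq> C"
    unfolding S_def S'_def using C pqr \<open>0 \<in> C\<close> open_triangle_subset[OF C(1) \<open>0 \<in> C\<close>] by simp
  ultimately show ?thesis using emeasure_mono[of "S \<union> S'" C lborel] C(2) by simp
qed

text \<open>This turns equality of areas into equality of sets. A point of \<open>C\<close> outside
  the closed set \<open>P\<close> is a limit of interior points of \<open>C\<close>, so
  \<open>C - P\<close> contains a non-empty open set, which has positive area; since
  \<open>P\<close> has finite area, \<open>C\<close> would be strictly larger.\<close>

lemma compact_subset_same_area:
  assumes "compact P" "convex C" "interior C \<noteq> {}" "closed C" "P \<subseteq> C" "emeasure lborel C = emeasure lborel P"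
  shows "C = P"
proof (rule ccontr)
  assume "C \<noteq> P"
  then obtain z where z: "z \<in> C" "z \<notin> P" using assms by blast
  have "z \<in> closure (interior C)" using z assms convex_closure_interior[of C] by simp
  moreover have "open (-P)" using assms compact_imp_closed by blast
  ultimately have "interior C \<inter> -P \<noteq> {}" using z(2)
    by (metis ComplI Int_commute closure_iff_nhds_not_empty order_refl)
  moreover have o: "open (interior C \<inter> -P)" using \<open>open (-P)\<close> by blast
  ultimately have "emeasure lborel (interior C \<inter> -P) \<noteq> 0"
    using open_not_negligible[OF o] null_sets_completionI[of _ lborel] o
    by (auto simp: negligible_iff_null_sets null_sets_def)
  moreover have "emeasure lborel P + emeasure lborel (interior C \<inter> -P) \<le> emeasure lborel C"
  proof -
    have "emeasure lborel P + emeasure lborel (interior C \<inter> -P) = emeasure lborel (P \<union> (interior C \<inter> -P))"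
      by (rule plus_emeasure) (use assms o in \<open>auto simp: compact_imp_closed\<close>)
    also have "\<dots> \<le> emeasure lborel C"
      by (rule emeasure_mono) (use assms interior_subset[of C] in auto)
    finally show ?thesis .
  qed
  moreover have "emeasure lborel P < \<infinity>" using assms emeasure_bounded_finite compact_imp_bounded by blast
  ultimately show False using assms(6)
    by (metis add.right_neutral ennreal_add_left_cancel_le infinity_ennreal_def le_zero_eq not_less_iff_gr_or_eq)
qed

section \<open>The lower bound\<close>

locale sym_body =
  fixes C :: "(real \<times> real) set"
  assumes compact_C: "compact C" and convex_C: "convex C" and interior_C: "interior C \<noteq> {}"
    and sym_C: "x \<in> C \<Longrightarrow> -x \<in> C"
begin

lemma borel_C: "C \<in> sets borel"
  using compact_C by (simp add: compact_imp_closed)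

lemma cross_subset: "p \<in> C \<Longrightarrow> q \<in> C \<Longrightarrow> convex hull {p, -p, q, -q} \<subseteq> C"
  by (rule hull_minimal) (auto simp: convex_C sym_C)

lemma cross_area_le:
  assumes "p \<in> C" "q \<in> C" "det2 p q \<noteq> 0"
  shows "ennreal (2 * \<bar>det2 p q\<bar>) \<le> emeasure lborel C"
  using emeasure_mono[OF cross_subset[OF assms(1,2)], of lborel] area_cross[OF assms(3)] borel_C by simp

lemma eq_cross:
  assumes "p \<in> C" "q \<in> C" "det2 p q \<noteq> 0" "emeasure lborel C = ennreal (2 * \<bar>det2 p q\<bar>)"
  shows "C = convex hull {p, -p, q, -q}"
  by (rule compact_subset_same_area)
    (use assms area_cross[OF assms(3)] cross_subset compact_C convex_C interior_C in
      \<open>auto simp: compact_imp_closed finite_imp_compact compact_convex_hull\<close>)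

end

locale slab_body = sym_body +
  fixes h :: real
  assumes h_pos: "0 < h" and fst_le: "x \<in> C \<Longrightarrow> fst x \<le> h" and fst_att: "\<exists>p\<in>C. fst p = h"
begin

lemma fst_ge: "x \<in> C \<Longrightarrow> - h \<le> fst x"
  using fst_le[OF sym_C] by fastforce

lemma vertical_segment:
  assumes "(x, y1) \<in> C" "(x, y2) \<in> C" "y1 \<le> y" "y \<le> y2"
  shows "(x, y) \<in> C"
proof (cases "y1 = y2")
  case False
  then have lt: "y1 < y2" using assms by simp
  have "((y2 - y) / (y2 - y1)) *\<^sub>R (x, y1) + ((y - y1) / (y2 - y1)) *\<^sub>R (x, y2) \<in> C"
    by (rule convexD[OF convex_C assms(1,2)]) (use assms lt in \<open>auto simp flip: add_divide_distrib\<close>)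
  moreover have "((y2 - y) / (y2 - y1)) *\<^sub>R (x, y1) + ((y - y1) / (y2 - y1)) *\<^sub>R (x, y2) = (x, y)"
    using lt by (auto simp: divide_simps) (auto simp: algebra_simps)
  ultimately show ?thesis by simp
qed (use assms in auto)

end

text \<open>By symmetry the width of \<open>C\<close> in a direction is twice the maximum of that
  functional on \<open>C\<close>. So \<open>width\<close> says that no lattice direction gives a
  width below \<open>2 * h\<close>, the width in direction (1,0).\<close>

locale width_body = slab_body +
  assumes width: "(a, b) \<noteq> (0, 0::int) \<Longrightarrow> \<exists>x\<in>C. h \<le> of_int a * fst x + of_int b * snd x"
begin

text \<open>The cross spanned by \<open>p\<close> and \<open>q\<close> has area
  \<open>2 * det2 p q\<close> and lies in \<open>C\<close>. If \<open>C\<close> has area only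
  \<open>2 * h^2\<close>, the cross leaves no room and fills \<open>C\<close>.\<close>

lemma cross_of_large_det:
  assumes "det2 p q \<ge> h\<^sup>2" "p \<in> C" "q \<in> C"
  shows "ennreal (2 * h\<^sup>2) \<le> emeasure lborel C"
    and "emeasure lborel C = ennreal (2 * h\<^sup>2) \<Longrightarrow> det2 p q = h\<^sup>2 \<and> C = convex hull {p, -p, q, -q}"
proof -
  have pos: "det2 p q > 0" using assms h_pos by (metis less_le_trans zero_less_power)
  have le: "ennreal (2 * det2 p q) \<le> emeasure lborel C" using cross_area_le[OF assms(2,3)] pos by simp
  then show "ennreal (2 * h\<^sup>2) \<le> emeasure lborel C"
    using assms(1) by (meson ennreal_leI mult_left_mono order_trans zero_le_numeral)
  assume eq: "emeasure lborel C = ennreal (2 * h\<^sup>2)"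
  then have "2 * det2 p q \<le> 2 * h\<^sup>2" using le by (simp add: ennreal_le_iff)
  then have "det2 p q = h\<^sup>2" using assms(1) by simp
  then show "det2 p q = h\<^sup>2 \<and> C = convex hull {p, -p, q, -q}"
    using eq_cross[OF assms(2,3)] eq pos by simp
qed

text \<open>Either a cross of sufficient area fits into \<open>C\<close>, or a hexagon makes the
  inequality strict. The implication in the first alternative records what equality says about the
  vertices; the classification of equality starts from it.\<close>

lemma lower_bound_dichotomy:
  obtains p q where "p \<in> C" "q \<in> C" "det2 p q \<ge> h\<^sup>2"
      "fst p = h"
      "det2 p q = h\<^sup>2 \<Longrightarrow> (\<exists>k::int. p = (h, k * h)) \<or> q = (0, h)"
  | "emeasure lborel C > ennreal (2 * h\<^sup>2)"
proof (cases "\<exists>k::int. (h, k * h) \<in> C")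
  case True
  then obtain k :: int where k: "(h, k * h) \<in> C" by blast
  \<comment> \<open>With \<open>p\<close> of slope \<open>k\<close>, \<open>det2 p q\<close> is
    \<open>h\<close> times the value of the direction (-k,1) at \<open>q\<close>, which is at least
    \<open>h\<close>.\<close>
  obtain q where q: "q \<in> C" "h \<le> of_int (-k) * fst q + of_int 1 * snd q"
    using width[of "-k" 1] by auto
  have "h * h \<le> h * (of_int (-k) * fst q + of_int 1 * snd q)" by (intro mult_left_mono q) (use h_pos in simp)
  then have "h\<^sup>2 \<le> det2 (h, k * h) q"
    by (simp add: det2_def power2_eq_square algebra_simps)
  then show thesis by (intro that(1)[OF k q(1)]) auto
next
  case False
  obtain p where p: "p \<in> C" "fst p = h" using fst_att by blast
  \<comment> \<open>\<open>a\<close> is the slope of \<open>p\<close>; its integral part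
    \<open>k\<close> selects the directions (-k,1) and (-k-1,1), which bracket the slope.\<close>
  define a where "a = snd p / h"
  define k where "k = \<lfloor>a\<rfloor>"
  define e where "e = a - k"
  have pe: "p = (h, (k + e) * h)" using p h_pos by (simp add: a_def e_def prod_eq_iff)
  have e01: "0 \<le> e" "e < 1" by (auto simp: e_def k_def) linarith
  have "e \<noteq> 0" using False p pe by auto
  then have e: "0 < e" "e < 1" using e01 by auto
  \<comment> \<open>The part of \<open>C\<close> on the line \<open>fst = h\<close> is a segment. It
    contains a point with slope strictly between \<open>k\<close> and \<open>k + 1\<close> but none
    with these slopes, so it stays strictly between them.\<close>
  have face: "k * h < y \<and> y < (k + 1) * h" if "(h, y) \<in> C" for y
  proof -
    have k': "k * h < (k + e) * h" "(k + e) * h < (k + 1) * h"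
      using e h_pos by auto
    have pC: "(h, (k + e) * h) \<in> C" using p pe by simp
    have "\<not> y \<le> k * h" using vertical_segment[OF that pC] False k' by fastforce
    moreover have "\<not> y \<ge> (k + 1) * h"
      using vertical_segment[OF pC that, of "of_int (k + 1) * h"] False k' by fastforce
    ultimately show ?thesis by auto
  qed
  obtain q where q: "q \<in> C" "h \<le> of_int (-k) * fst q + of_int 1 * snd q"
    using width[of "-k" 1] by auto
  obtain r where r: "r \<in> C" "h \<le> of_int (-(k+1)) * fst r + of_int 1 * snd r"
    using width[of "-(k+1)" 1] by auto
  \<comment> \<open>After the shear that subtracts \<open>k\<close> times the first coordinate from
    the second, the points are \<open>p = (h, e h)\<close>, \<open>q = (x, A)\<close> and
    \<open>r = (-z, B)\<close>. The sign of \<open>z\<close> is chosen so that \<open>0 < x\<close>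
    and \<open>0 < z\<close> is the hexagon case.\<close>
  define x where "x = fst q"
  define A where "A = snd q - k * fst q"
  define z where "z = - fst r"
  define B where "B = snd r - k * fst r"
  have A: "A \<ge> h" using q by (simp add: A_def)
  have B: "B \<ge> h - z" using r by (simp add: B_def z_def algebra_simps)
  have dpq: "det2 p q = h * (A - e * x)" by (simp add: pe det2_def A_def x_def algebra_simps)
  have dpr: "det2 p r = h * (B + e * z)" by (simp add: pe det2_def B_def z_def algebra_simps)
  have dqr: "det2 q r = x * B + z * A" by (simp add: det2_def A_def B_def x_def z_def algebra_simps)
  show thesis
  \<comment> \<open>If \<open>x \<le> 0\<close>, the cross of \<open>p\<close> and \<open>q\<close>
    is large enough; if \<open>z \<le> 0\<close>, that of \<open>p\<close> and \<open>r\<close> is.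
    Equality forces the second vertex to be \<open>(0, h)\<close> because
    \<open>0 < e < 1\<close>.\<close>
  proof (cases "x \<le> 0")
    case True
    then have "e * x \<le> 0" using e by (simp add: mult_nonneg_nonpos)
    then have "h * h \<le> h * (A - e * x)" using A h_pos by (intro mult_left_mono) auto
    then have le: "h\<^sup>2 \<le> det2 p q" by (simp add: dpq power2_eq_square)
    moreover have "q = (0, h)" if "det2 p q = h\<^sup>2"
    proof -
      have "A - e * x = h" using that h_pos by (simp add: dpq power2_eq_square)
      then have "e * x = 0" "A = h" using A \<open>e * x \<le> 0\<close> by auto
      then show ?thesis using e by (simp add: x_def A_def prod_eq_iff)
    qed
    ultimately show thesis using that(1)[OF p(1) q(1) _ p(2)] by blast
  next
    case x: False
    show thesis
    proof (cases "z \<le> 0")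
      case True
      have id: "B + e * z = (B + z) - (1 - e) * z" by (simp add: algebra_simps)
      have z: "(1 - e) * z \<le> 0" using True e by (simp add: mult_nonneg_nonpos)
      then have "h * h \<le> h * (B + e * z)" unfolding id using B h_pos by (intro mult_left_mono) auto
      then have le: "h\<^sup>2 \<le> det2 p r" by (simp add: dpr power2_eq_square)
      moreover have "r = (0, h)" if "det2 p r = h\<^sup>2"
      proof -
        have "(B + z) - (1 - e) * z = h" using that h_pos unfolding id[symmetric] by (simp add: dpr power2_eq_square)
        then have "(1 - e) * z = 0" "B + z = h" using B z by auto
        then show ?thesis using e by (simp add: z_def B_def prod_eq_iff)
      qed
      ultimately show thesis using that(1)[OF p(1) r(1) _ p(2)] by blast
    next
      case z: False
      \<comment> \<open>Otherwise \<open>q\<close> would be on the line \<open>fst = h\<close> with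
        slope at least \<open>k + 1\<close>. Likewise \<open>z = h\<close> would put
        \<open>-r\<close> there with slope at most \<open>k\<close>. Both contradict
        \<open>face\<close>.\<close>
      have "x < h"
      proof (rule ccontr)
        assume "\<not> x < h"
        then have "q = (h, A + k * h)" using fst_le[OF q(1)] by (auto simp: x_def A_def prod_eq_iff)
        then show False using face[of "A + k * h"] q A by (simp add: algebra_simps)
      qed
      have "z < h"
      proof (rule ccontr)
        assume "\<not> z < h"
        then have "z = h" using fst_ge[OF r(1)] by (auto simp: z_def)
        then have "-r = (h, k * h - B)" by (auto simp: z_def B_def prod_eq_iff)
        then show False using face[of "k * h - B"] sym_C[OF r(1)] B \<open>z = h\<close> by auto
      qed
      have x0: "0 < x" and z0: "0 < z" using x z by auto
      have "e * x < 1 * h" using e x0 \<open>x < h\<close> by (intro mult_strict_mono) auto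
      then have pos1: "det2 p q > 0" using A h_pos by (simp add: dpq)
      have "(1 - e) * z < 1 * h" using e z0 \<open>z < h\<close> by (intro mult_strict_mono) auto
      then have "B + e * z > 0" using B by (simp add: algebra_simps)
      then have pos2: "det2 p r > 0" using h_pos by (simp add: dpr)
      have pos3: "det2 q r > 0" unfolding dqr
        using x0 z0 A B \<open>z < h\<close> h_pos by (intro add_pos_pos mult_pos_pos) auto
      \<comment> \<open>The excess of the hexagon over \<open>2 * h^2\<close> splits into four
        nonnegative products; the first two are positive since \<open>e\<close>, \<open>x/h\<close>
        and \<open>z/h\<close> all lie strictly between 0 and 1.\<close>
      have "det2 p q + det2 q r + det2 p r = 2 * h\<^sup>2 + (1 - e) * x * (h - z) + e * z * (h - x)
          + (A - h) * (h + z) + (B - (h - z)) * (h + x)"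
        by (simp add: dpq dpr dqr power2_eq_square algebra_simps)
      moreover have "(1 - e) * x * (h - z) > 0" "e * z * (h - x) > 0" "(A - h) * (h + z) \<ge> 0" "(B - (h - z)) * (h + x) \<ge> 0"
        using e x0 z0 \<open>x < h\<close> \<open>z < h\<close> A B h_pos by auto
      ultimately have "2 * h\<^sup>2 < det2 p q + det2 q r + det2 p r" by linarith
      then have "ennreal (2 * h\<^sup>2) < ennreal (det2 p q + det2 q r + det2 p r)"
        using pos1 pos2 pos3 by (intro ennreal_lessI) auto
      also have "\<dots> \<le> emeasure lborel C"
        by (rule hexagon_area_le[OF convex_C borel_C sym_C p(1) q(1) r(1) pos1 pos3 pos2])
      finally show thesis by (rule that(2))
    qed
  qed
qed

end

section \<open>Unimodular maps and the integer lattice\<close>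

abbreviation int_lin :: "int \<Rightarrow> int \<Rightarrow> int \<Rightarrow> int \<Rightarrow> real \<times> real \<Rightarrow> real \<times> real" where
  "int_lin a b c d \<equiv> lin (of_int a) (of_int b) (of_int c) (of_int d)"

lemma mem_Z2: "x \<in> Z2 \<longleftrightarrow> (\<exists>i j. x = (of_int i, of_int j))"
  by (cases x) (auto simp: Z2_def Ints_def)

lemma add_Z2: "x \<in> Z2 \<Longrightarrow> y \<in> Z2 \<Longrightarrow> x + y \<in> Z2" and diff_Z2: "x \<in> Z2 \<Longrightarrow> y \<in> Z2 \<Longrightarrow> x - y \<in> Z2"
  by (auto simp: Z2_def)

lemma int_lin_Z2: "x \<in> Z2 \<Longrightarrow> int_lin a b c d x \<in> Z2"
  by (auto simp: Z2_def lin_def)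

text \<open>A determinant \<open>D\<close> equal to 1 or -1 is its own reciprocal, so multiplying
  the adjugate by \<open>D\<close> gives the inverse with integer entries.\<close>

lemma int_lin_inverse:
  assumes "\<bar>a * d - b * c\<bar> = 1"
  defines "D \<equiv> a * d - b * c"
  shows "int_lin (d*D) (-b*D) (-c*D) (a*D) (int_lin a b c d x) = x"
    and "int_lin a b c d (int_lin (d*D) (-b*D) (-c*D) (a*D) x) = x"
    and "\<bar>(d*D) * (a*D) - (-b*D) * (-c*D)\<bar> = 1"
proof -
  have D: "D = 1 \<or> D = -1" using assms by linarith
  then have DD: "D * D = 1" by auto
  have r: "real_of_int D * real_of_int D = 1" using DD by (metis of_int_1 of_int_mult)
  have "real_of_int D = real_of_int a * d - real_of_int b * c" by (simp add: D_def)
  then have e: "real_of_int D * (real_of_int a * d - real_of_int b * c) = 1" using r by simp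
  show "int_lin (d*D) (-b*D) (-c*D) (a*D) (int_lin a b c d x) = x"
    and "int_lin a b c d (int_lin (d*D) (-b*D) (-c*D) (a*D) x) = x"
    unfolding lin_lin using e by (auto simp: lin_def prod_eq_iff algebra_simps)
  have "(d*D) * (a*D) - (-b*D) * (-c*D) = (D * D) * D" by (simp add: D_def algebra_simps)
  then show "\<bar>(d*D) * (a*D) - (-b*D) * (-c*D)\<bar> = 1" using D DD by auto
qed

lemma unimodular_int_lin:
  assumes "\<bar>a * d - b * c\<bar> = 1" "t \<in> Z2"
  shows "unimodular (\<lambda>x. int_lin a b c d x + t)"
proof -
  let ?f = "\<lambda>x. int_lin a b c d x + t"
  obtain a' b' c' d' :: int where inv: "\<And>x. int_lin a' b' c' d' (int_lin a b c d x) = x" "\<And>x. int_lin a b c d (int_lin a' b' c' d' x) = x"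
    using int_lin_inverse[OF assms(1)] by blast
  let ?g = "\<lambda>y. int_lin a' b' c' d' (y - t)"
  have gf: "?g (?f x) = x" and fg: "?f (?g x) = x" for x using inv by auto
  have "bij ?f" using gf fg by (intro bij_betw_byWitness[where f'="?g"]) auto
  moreover have "?f ` Z2 = Z2"
  proof
    show "?f ` Z2 \<subseteq> Z2" using int_lin_Z2 add_Z2 assms by blast
    show "Z2 \<subseteq> ?f ` Z2"
    proof
      fix y assume "y \<in> Z2"
      then have "?g y \<in> Z2" using int_lin_Z2 diff_Z2 assms by blast
      then show "y \<in> ?f ` Z2" using fg[of y] by (metis image_eqI)
    qed
  qed
  ultimately show ?thesis unfolding unimodular_def using linear_lin by blast
qed

text \<open>The images of 0 and of the unit vectors are lattice points, which makes the translation
  and the matrix integral. Since the map is onto the lattice, the matrix has an integral right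
  inverse, and the product of the two determinants is 1.\<close>

lemma unimodularE:
  assumes "unimodular f"
  obtains a b c d t where "\<bar>a * d - b * c\<bar> = (1::int)" "t \<in> Z2" "f = (\<lambda>x. int_lin a b c d x + t)"
proof -
  obtain L t where L: "linear L" "f = (\<lambda>x. L x + t)" and Z: "f ` Z2 = Z2"
    using assms unfolding unimodular_def by blast
  have "(0,0) \<in> Z2" "(1,0) \<in> Z2" "(0,1) \<in> Z2" by (auto simp: Z2_def)
  then have mem: "f (0,0) \<in> Z2" "f (1,0) \<in> Z2" "f (0,1) \<in> Z2" using Z by blast+
  have L0: "L (0,0) = 0" using linear_0[OF L(1)] by (simp add: zero_prod_def)
  then have t: "t \<in> Z2" using mem L by simp
  have "L (1,0) \<in> Z2" "L (0,1) \<in> Z2" using diff_Z2[OF mem(2) t] diff_Z2[OF mem(3) t] L by auto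
  then obtain a b c d :: int where M: "L (1,0) = (of_int a, of_int c)" "L (0,1) = (of_int b, of_int d)" unfolding mem_Z2 by blast
  have Lx: "L x = int_lin a b c d x" for x
  proof -
    have "L x = L (fst x *\<^sub>R (1,0) + snd x *\<^sub>R (0,1))" by (simp add: prod_eq_iff)
    also have "\<dots> = fst x *\<^sub>R L (1,0) + snd x *\<^sub>R L (0,1)"
      by (simp only: linear_add[OF L(1)] linear_scale[OF L(1)])
    finally show ?thesis by (simp add: M lin_def prod_eq_iff)
  qed
  \<comment> \<open>The lattice preimages of these two points are the columns of the inverse
    matrix.\<close>
  have "t + (1,0) \<in> Z2" "t + (0,1) \<in> Z2" using t by (auto simp: Z2_def)
  then have "t + (1,0) \<in> f ` Z2" "t + (0,1) \<in> f ` Z2" using Z by auto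
  then obtain x y where xy: "x \<in> Z2" "y \<in> Z2" "t + (1,0) = f x" "t + (0,1) = f y" by blast
  then obtain i j k l :: int where ijkl: "x = (of_int i, of_int j)" "y = (of_int k, of_int l)" unfolding mem_Z2 by blast
  have "real_of_int a * i + b * j = 1" "real_of_int c * i + d * j = 0"
      "real_of_int a * k + b * l = 0" "real_of_int c * k + d * l = 1"
    using xy(3,4) by (auto simp: L Lx ijkl lin_def prod_eq_iff)
  then have "a * i + b * j = 1" "c * i + d * j = 0" "a * k + b * l = 0" "c * k + d * l = 1"
    by (simp_all flip: of_int_mult of_int_add)
  then have "(a * d - b * c) * (i * l - j * k) = 1" by algebra
  then have "\<bar>a * d - b * c\<bar> = 1" by (metis abs_mult_self_eq abs_zmult_eq_1 abs_1)
  then show thesis using that[of a d b c t] t L Lx by auto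
qed

lemma unimodular_compose: "unimodular f \<Longrightarrow> unimodular g \<Longrightarrow> unimodular (f \<circ> g)"
proof -
  assume f: "unimodular f" and g: "unimodular g"
  obtain L b L' b' where L: "linear L" "f = (\<lambda>x. L x + b)" "linear L'" "g = (\<lambda>x. L' x + b')"
    using f g unfolding unimodular_def by blast
  have "f \<circ> g = (\<lambda>x. (L \<circ> L') x + (L b' + b))" by (auto simp: L linear_add)
  moreover have "linear (L \<circ> L')" using L linear_compose by blast
  moreover have "bij (f \<circ> g)" using f g by (simp add: unimodular_def bij_comp)
  moreover have "(f \<circ> g) ` Z2 = Z2" using f g by (simp only: unimodular_def image_comp[symmetric])
  ultimately show ?thesis unfolding unimodular_def by blast
qed

lemma area_unimodular_image:
  assumes "unimodular f" "compact S"
  shows "emeasure lborel (f ` S) = emeasure lborel S"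
proof -
  obtain a b c d t where f: "\<bar>a * d - b * c\<bar> = (1::int)" "f = (\<lambda>x. int_lin a b c d x + t)"
    using assms(1) by (rule unimodularE)
  have D: "\<bar>real_of_int a * d - real_of_int b * c\<bar> = 1"
    using f(1) by (metis of_int_1 of_int_abs of_int_diff of_int_mult)
  have im: "f ` S = (+) t ` (int_lin a b c d ` S)" by (simp add: f image_comp o_def add.commute)
  have "compact (int_lin a b c d ` S)" using assms compact_continuous_image continuous_on_lin by blast
  then have "emeasure lborel (f ` S) = emeasure lborel (int_lin a b c d ` S)"
    unfolding im by (intro emeasure_lborel_translate) (simp add: compact_imp_closed)
  also have "\<dots> = ennreal \<bar>real_of_int a * d - real_of_int b * c\<bar> * emeasure lborel S"
    by (rule emeasure_lin_image) (use assms D in \<open>auto simp: compact_imp_closed compact_imp_bounded\<close>)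
  finally show ?thesis using D by simp
qed

lemma unimodular_inv:
  assumes "unimodular f"
  shows "unimodular (inv f)"
proof -
  obtain a b c d t where f: "\<bar>a * d - b * c\<bar> = (1::int)" "t \<in> Z2" "f = (\<lambda>x. int_lin a b c d x + t)"
    using assms by (rule unimodularE)
  obtain a' b' c' d' :: int where inv: "\<And>x. int_lin a' b' c' d' (int_lin a b c d x) = x"
      "\<And>x. int_lin a b c d (int_lin a' b' c' d' x) = x" "\<bar>a' * d' - b' * c'\<bar> = 1"
    using int_lin_inverse[OF f(1)] by blast
  have "inv f = (\<lambda>y. int_lin a' b' c' d' y + int_lin a' b' c' d' (- t))"
    by (rule inv_equality) (simp_all add: f(3) inv(1,2) flip: linear_add[OF linear_lin])
  moreover have "- t \<in> Z2" using f(2) by (auto simp: Z2_def)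
  ultimately show ?thesis using unimodular_int_lin[OF inv(3) int_lin_Z2] by simp
qed

text \<open>By continuity and injectivity the interior of the image pulls back into the interior of
  \<open>K\<close>, so a lattice point there would come from one in the interior of
  \<open>K\<close>.\<close>

lemma lattice_free_image:
  assumes f: "unimodular f" and K: "interior K \<inter> Z2 = {}"
  shows "interior (f ` K) \<inter> Z2 = {}"
proof -
  have bij: "bij f" and Z: "f ` Z2 = Z2" using f unfolding unimodular_def by auto
  obtain L b where L: "linear L" "f = (\<lambda>x. L x + b)" using f unfolding unimodular_def by blast
  have cont: "continuous_on UNIV f" unfolding L
    by (intro continuous_intros linear_continuous_on) (simp add: L linear_conv_bounded_linear[symmetric])
  have "interior (f ` K) \<subseteq> f ` interior K"
  proof
    fix y assume y: "y \<in> interior (f ` K)"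
    have "open (f -` interior (f ` K))" using cont by (simp add: continuous_on_open_vimage)
    moreover have "f -` interior (f ` K) \<subseteq> K"
      using interior_subset[of "f ` K"] inj_image_mem_iff[OF bij_is_inj[OF bij]] by blast
    ultimately have "f -` interior (f ` K) \<subseteq> interior K" by (simp add: interior_maximal)
    moreover obtain x where "y = f x" using bij by (metis bij_pointE)
    ultimately show "y \<in> f ` interior K" using y by auto
  qed
  moreover have "f ` interior K \<inter> f ` Z2 = {}"
    using K by (simp flip: image_Int[OF bij_is_inj[OF bij]])
  ultimately show ?thesis using Z by auto
qed

text \<open>In the basis \<open>(h, m h)\<close>, \<open>(0, g)\<close> the point has coordinates
  \<open>fst x / h\<close> and \<open>(snd x - m * fst x) / g\<close>; strict inequality for their
  1-norm is an open condition.\<close>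

lemma mem_interior_cross:
  fixes h g m :: real and x :: "real \<times> real"
  assumes "0 < h" "0 < g" and x: "\<bar>fst x\<bar> / h + \<bar>snd x - m * fst x\<bar> / g < 1"
  shows "x \<in> interior (convex hull {(h, m * h), -(h, m * h), (0, g), -(0, g)})"
proof -
  let ?U = "{x. \<bar>fst x\<bar> / h + \<bar>snd x - m * fst x\<bar> / g < 1}"
  have "open ((\<lambda>x. \<bar>fst x\<bar> / h + \<bar>snd x - m * fst x\<bar> / g) -` {..<1})"
    using assms by (intro open_vimage) (auto intro!: continuous_intros)
  then have "open ?U" by (simp add: vimage_def)
  moreover have "?U \<subseteq> convex hull {(h, m * h), -(h, m * h), (0, g), -(0, g)}"
  proof
    fix y assume y: "y \<in> ?U"
    have "y = (fst y / h) *\<^sub>R (h, m * h) + ((snd y - m * fst y) / g) *\<^sub>R (0, g)"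
      using assms by (simp add: prod_eq_iff)
    moreover have "\<bar>fst y / h\<bar> + \<bar>(snd y - m * fst y) / g\<bar> \<le> 1" using y assms by auto
    ultimately show "y \<in> convex hull {(h, m * h), -(h, m * h), (0, g), -(0, g)}"
      unfolding convex_hull_cross by blast
  qed
  ultimately have "?U \<subseteq> interior (convex hull {(h, m * h), -(h, m * h), (0, g), -(0, g)})"
    by (simp add: interior_maximal)
  then show ?thesis using x by blast
qed

text \<open>On two adjacent vertical lattice lines, the minima of the left-hand side average to at most
  \<open>max (1 + \<alpha>) (2 - \<alpha>) / 2\<close>.\<close>

lemma lattice_covering:
  fixes \<alpha> h t1 t2 :: real
  assumes "0 \<le> \<alpha>" "\<alpha> < 1" "1 + \<alpha> < 2 * h" "2 - \<alpha> < 2 * h"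
  shows "\<exists>i j :: int. \<bar>of_int i - t1\<bar> + \<bar>(of_int j - t2) - \<alpha> * (of_int i - t1)\<bar> < h"
proof -
  \<comment> \<open>The lattice lines \<open>i\<close> and \<open>i - 1\<close> enclose
    \<open>t1\<close>, at distances \<open>s\<close> and \<open>1 - s\<close>. \<open>v\<close> is
    the fractional position of the lattice points on line \<open>i\<close> relative to the sheared
    centre.\<close>
  define i where "i = \<lceil>t1\<rceil>"
  define s where "s = i - t1"
  define V where "V = - t2 - \<alpha> * s"
  define m where "m = \<lfloor>V\<rfloor>"
  define v where "v = V - m"
  have s: "0 \<le> s" "s < 1" unfolding s_def i_def by linarith+
  have v: "0 \<le> v" "v < 1" unfolding v_def m_def by linarith+
  have val1: "\<bar>of_int i - t1\<bar> + \<bar>(of_int j - t2) - \<alpha> * (of_int i - t1)\<bar> = s + \<bar>j + m + v\<bar>" for j :: int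
    using s by (simp add: v_def V_def s_def)
  have val2: "\<bar>of_int (i-1) - t1\<bar> + \<bar>(of_int j - t2) - \<alpha> * (of_int (i-1) - t1)\<bar> = 1 - s + \<bar>j + m + v + \<alpha>\<bar>" for j :: int
    using s by (simp add: v_def V_def s_def algebra_simps)
  \<comment> \<open>In each case one lattice point is picked on each line. The two values add up to
    \<open>2 - \<alpha>\<close> in the first case and to \<open>1 + \<alpha>\<close> in the second;
    both sums are below \<open>2 * h\<close>, so one value is below \<open>h\<close>.\<close>
  show ?thesis
  proof (cases "v \<le> 1 - \<alpha>")
    case True
    have "s + v < h \<or> 1 - s + (1 - v - \<alpha>) < h" using assms by linarith
    then show ?thesis
    proof
      assume "s + v < h"
      then show ?thesis using val1[of "-m"] v by (intro exI[of _ i] exI[of _ "-m"]) simp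
    next
      assume "1 - s + (1 - v - \<alpha>) < h"
      then show ?thesis using val2[of "-m-1"] True v by (intro exI[of _ "i-1"] exI[of _ "-m-1"]) simp
    qed
  next
    case False
    have "s + (1 - v) < h \<or> 1 - s + (v + \<alpha> - 1) < h" using assms by linarith
    then show ?thesis
    proof
      assume "s + (1 - v) < h"
      then show ?thesis using val1[of "-m-1"] v by (intro exI[of _ i] exI[of _ "-m-1"]) simp
    next
      assume "1 - s + (v + \<alpha> - 1) < h"
      then show ?thesis using val2[of "-m-1"] False v by (intro exI[of _ "i-1"] exI[of _ "-m-1"]) simp
    qed
  qed
qed

text \<open>Rounding leaves at most 1/2 in each coordinate, so a 1-norm distance of at least 1
  forces exactly 1/2 twice. This locates the centre of a lattice-free unit cross.\<close>

lemma half_int_of_lattice_free: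
  fixes t1 t2 :: real
  assumes "\<And>i j :: int. 1 \<le> \<bar>of_int i - t1\<bar> + \<bar>of_int j - t2\<bar>"
  shows "(t1, t2) - (1/2, 1/2) \<in> Z2"
proof -
  have "\<bar>of_int (round t1) - t1\<bar> \<le> 1/2" "\<bar>of_int (round t2) - t2\<bar> \<le> 1/2"
    by (rule of_int_round_abs_le)+
  then have "\<bar>of_int (round t1) - t1\<bar> = 1/2" "\<bar>of_int (round t2) - t2\<bar> = 1/2"
    using assms[of "round t1" "round t2"] by linarith+
  then have "t1 - 1/2 = of_int (round t1) \<or> t1 - 1/2 = of_int (round t1 - 1)"
      "t2 - 1/2 = of_int (round t2) \<or> t2 - 1/2 = of_int (round t2 - 1)"
    by (auto simp: abs_if split: if_splits)
  then show ?thesis by (auto simp: Z2_def simp del: of_int_diff)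
qed

section \<open>The lower bound for the area and the shape in the case of equality\<close>

context width_body begin

lemma area_ge: "ennreal (2 * h\<^sup>2) \<le> emeasure lborel C"
  by (rule lower_bound_dichotomy) (use cross_of_large_det(1) in \<open>auto intro: less_imp_le\<close>)

text \<open>\<open>C\<close> is the cross of \<open>p\<close> and \<open>q\<close>. If
  \<open>q = (0, h)\<close>, a vertical shear reduces the slope of \<open>p\<close> to its
  fractional part. If \<open>p = (h, k h)\<close>, the determinant puts \<open>q\<close> at height
  \<open>h\<close> in direction (-k,1); shearing by \<open>k\<close>, exchanging the coordinates and
  shearing by \<open>l\<close> leads to the same form, with the roles of \<open>p\<close> and
  \<open>q\<close> exchanged.\<close>

lemma area_eq_imp_shape:
  assumes "emeasure lborel C = ennreal (2 * h\<^sup>2)"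
  obtains a d b c :: int and \<alpha> :: real where "\<bar>a * d - b * c\<bar> = 1" "0 \<le> \<alpha>" "\<alpha> < 1"
    "int_lin a b c d ` C = convex hull {(h, \<alpha> * h), -(h, \<alpha> * h), (0, h), -(0, h)}"
proof (rule lower_bound_dichotomy)
  assume "ennreal (2 * h\<^sup>2) < emeasure lborel C"
  then show thesis using assms by simp
next
  fix p q assume pq: "p \<in> C" "q \<in> C" "h\<^sup>2 \<le> det2 p q" "fst p = h"
    and cases: "det2 p q = h\<^sup>2 \<Longrightarrow> (\<exists>k::int. p = (h, k * h)) \<or> q = (0, h)"
  have det: "det2 p q = h\<^sup>2" and C: "C = convex hull {p, -p, q, -q}"
    using cross_of_large_det(2)[OF pq(3,1,2) assms] by auto
  have img: "int_lin a b c d ` C = convex hull {int_lin a b c d p, - int_lin a b c d p, int_lin a b c d q, - int_lin a b c d q}" for a b c d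
    unfolding C convex_hull_linear_image[OF linear_lin] by (simp add: linear_neg[OF linear_lin])
  from cases[OF det] consider (a) k :: int where "p = (h, k * h)" | (b) "q = (0, h)" by blast
  then show thesis
  proof cases
    case a
    define l where "l = \<lfloor>fst q / h\<rfloor>"
    have q: "snd q = h + k * fst q" using det h_pos
      by (simp add: a det2_def power2_eq_square algebra_simps) (metis add.commute distrib_left mult.left_commute mult_cancel_left less_irrefl)
    have "int_lin (-k) 1 (1 + l * k) (-l) p = (0, h)" by (simp add: a lin_def algebra_simps)
    moreover have "int_lin (-k) 1 (1 + l * k) (-l) q = (h, frac (fst q / h) * h)"
      using h_pos by (simp add: lin_def q frac_def l_def algebra_simps)
    ultimately have "int_lin (-k) 1 (1 + l * k) (-l) ` C =
        convex hull {(h, frac (fst q / h) * h), -(h, frac (fst q / h) * h), (0, h), -(0, h)}"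
      unfolding img by (simp add: insert_commute)
    then show thesis by (intro that[of "-k" "-l" 1 "1 + l * k" "frac (fst q / h)"]) (auto simp: frac_lt_1)
  next
    case b
    define l where "l = \<lfloor>snd p / h\<rfloor>"
    have "int_lin 1 0 (-l) 1 p = (h, frac (snd p / h) * h)"
      using h_pos pq(4) by (simp add: lin_def frac_def l_def algebra_simps)
    moreover have "int_lin 1 0 (-l) 1 q = (0, h)" by (simp add: b lin_def)
    ultimately have "int_lin 1 0 (-l) 1 ` C =
        convex hull {(h, frac (snd p / h) * h), -(h, frac (snd p / h) * h), (0, h), -(0, h)}"
      unfolding img by simp
    then show thesis by (intro that[of 1 1 0 "-l" "frac (snd p / h)"]) (auto simp: frac_lt_1)
  qed
qed

end

section \<open>The upper bound\<close>

context slab_body begin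

definition roof :: "real \<Rightarrow> real" where "roof x = Sup {y. (x, y) \<in> C}"

text \<open>By central symmetry the lower boundary of \<open>C\<close> above \<open>x\<close> is
  \<open>- roof (- x)\<close>, so this is the length of the vertical chord at \<open>x\<close>, in a
  form that is visibly even.\<close>

definition chord :: "real \<Rightarrow> real" where "chord x = roof x + roof (- x)"

lemma roof_props:
  assumes "\<bar>x\<bar> \<le> h"
  shows roof_mem: "(x, roof x) \<in> C" and roof_ge: "(x, y) \<in> C \<Longrightarrow> y \<le> roof x"
proof -
  obtain p where p: "p \<in> C" "fst p = h" using fst_att by blast
  \<comment> \<open>The slice at \<open>x\<close> is non-empty: it contains \<open>(x/h) p\<close>,
    a convex combination of the touching point \<open>p\<close> and its reflection.\<close>
  have "((1 + x/h) / 2) *\<^sub>R p + ((1 - x/h) / 2) *\<^sub>R (-p) \<in> C"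
    by (rule convexD[OF convex_C p(1) sym_C[OF p(1)]]) (use assms h_pos in \<open>auto simp: field_simps abs_le_iff\<close>)
  moreover have "((1 + x/h) / 2) *\<^sub>R p + ((1 - x/h) / 2) *\<^sub>R (-p) = (x/h) *\<^sub>R p"
    by (simp add: scaleR_left_distrib[symmetric] flip: scaleR_minus_left) (simp add: field_simps)
  ultimately have "(x, x / h * snd p) \<in> C" using p h_pos by (simp add: prod_eq_iff scaleR_prod_def)
  then have ne: "{y. (x, y) \<in> C} \<noteq> {}" by blast
  have "{y. (x, y) \<in> C} = snd ` (C \<inter> {z. fst z = x})" by force
  moreover have "compact (C \<inter> {z. fst z = x})"
    by (intro compact_Int_closed compact_C closed_Collect_eq continuous_intros)
  ultimately have "compact {y. (x, y) \<in> C}" by (simp add: compact_continuous_image continuous_on_snd)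
  then obtain y where y: "(x, y) \<in> C" "\<And>z. (x, z) \<in> C \<Longrightarrow> z \<le> y"
    using compact_attains_sup[OF _ ne] by auto
  then have "roof x = y" unfolding roof_def by (intro cSup_eq_maximum) auto
  then show "(x, roof x) \<in> C" "(x, y) \<in> C \<Longrightarrow> y \<le> roof x" for y using y by auto
qed

lemma floor_mem: "\<bar>x\<bar> \<le> h \<Longrightarrow> (x, - roof (- x)) \<in> C"
  using sym_C[OF roof_mem[of "-x"]] by simp

lemma floor_le: "\<bar>x\<bar> \<le> h \<Longrightarrow> (x, y) \<in> C \<Longrightarrow> - roof (- x) \<le> y"
  using roof_ge[of "-x" "-y"] sym_C[of "(x, y)"] by simp

lemma chord_nonneg: "\<bar>x\<bar> \<le> h \<Longrightarrow> 0 \<le> chord x"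
  using floor_le[OF _ roof_mem] by (fastforce simp: chord_def)

lemma chord_even: "chord (- x) = chord x" "chord \<bar>x\<bar> = chord x"
  by (auto simp: chord_def abs_if)

lemma slice_eq:
  assumes x: "\<bar>x\<bar> \<le> h"
  shows "{y. (x, y) \<in> C} = {- roof (- x)..roof x}"
proof (intro equalityI subsetI)
  show "y \<in> {- roof (- x)..roof x}" if "y \<in> {y. (x, y) \<in> C}" for y
    using roof_ge[OF x, of y] floor_le[OF x, of y] that by simp
  show "y \<in> {y. (x, y) \<in> C}" if "y \<in> {- roof (- x)..roof x}" for y
    using vertical_segment[OF floor_mem[OF x] roof_mem[OF x], of y] that by simp
qed

lemma emeasure_slice: "\<bar>x\<bar> \<le> h \<Longrightarrow> emeasure lborel {y. (x, y) \<in> C} = ennreal (chord x)"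
  using chord_nonneg[of x] by (simp add: slice_eq chord_def add.commute)

lemma roof_concave:
  assumes "\<bar>x\<bar> \<le> h" "\<bar>y\<bar> \<le> h" "0 \<le> u" "0 \<le> v" "u + v = 1"
  shows "u * roof x + v * roof y \<le> roof (u * x + v * y)"
proof -
  have "\<bar>u * x + v * y\<bar> \<le> u * \<bar>x\<bar> + v * \<bar>y\<bar>"
    using assms abs_triangle_ineq[of "u * x" "v * y"] by (simp add: abs_mult)
  also have "\<dots> \<le> u * h + v * h" using assms by (intro add_mono mult_left_mono) auto
  also have "\<dots> = h" using assms by (metis distrib_right mult_1)
  finally have le: "\<bar>u * x + v * y\<bar> \<le> h" .
  have "u *\<^sub>R (x, roof x) + v *\<^sub>R (y, roof y) \<in> C"
    by (rule convexD[OF convex_C]) (use assms roof_mem in auto)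
  then show ?thesis using roof_ge[OF le] by simp
qed

lemma chord_concave:
  assumes "\<bar>x\<bar> \<le> h" "\<bar>y\<bar> \<le> h" "0 \<le> u" "0 \<le> v" "u + v = 1"
  shows "u * chord x + v * chord y \<le> chord (u * x + v * y)"
  using roof_concave[OF assms] roof_concave[of "-x" "-y" u v] assms by (simp add: chord_def algebra_simps)

text \<open>\<open>s\<close> is a convex combination of \<open>t\<close> and \<open>-t\<close>,
  where the even function \<open>chord\<close> takes the same value; concavity does the
  rest.\<close>

lemma chord_antimono:
  assumes "0 \<le> s" "s \<le> t" "t \<le> h"
  shows "chord t \<le> chord s"
proof (cases "t = 0")
  case False
  let ?u = "(1 + s/t)/2" and ?v = "(1 - s/t)/2"
  have "?u * chord t + ?v * chord (-t) \<le> chord (?u * t + ?v * (-t))"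
    by (rule chord_concave) (use assms False in \<open>auto simp: field_simps\<close>)
  moreover have "?u * t + ?v * (-t) = s" using False by (simp add: field_simps)
  moreover have "?u * chord t + ?v * chord (-t) = chord t" by (simp add: chord_even field_simps)
  ultimately show ?thesis by simp
qed (use assms in auto)

text \<open>A supporting line of the concave function \<open>chord\<close> at \<open>s\<close>:
  \<open>-m\<close> is its right-hand slope, obtained as the infimum of the downward difference
  quotients. Monotonicity gives \<open>0 \<le> m\<close>, and the quotient at \<open>t = h\<close>
  with \<open>0 \<le> chord h\<close> limits the steepness. Evenness extends the bound to negative
  \<open>x\<close>.\<close>

lemma chord_support:
  assumes s: "0 \<le> s" "s < h"
  obtains m where "0 \<le> m" "m * (h - s) \<le> chord s" "\<And>x. \<bar>x\<bar> \<le> h \<Longrightarrow> chord x \<le> chord s + m * (s - \<bar>x\<bar>)"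
proof -
  define S where "S = (\<lambda>t. (chord s - chord t) / (t - s)) ` {s<..h}"
  define m where "m = Inf S"
  have ne: "S \<noteq> {}" using s by (auto simp: S_def)
  have nn: "0 \<le> z" if "z \<in> S" for z
    using that s chord_antimono[of s] by (auto simp: S_def)
  have bdd: "bdd_below S" using nn by (intro bdd_belowI[of _ 0])
  have le: "m * (t - s) \<le> chord s - chord t" if "s < t" "t \<le> h" for t
  proof -
    have "m \<le> (chord s - chord t) / (t - s)" unfolding m_def
      by (rule cInf_lower[OF _ bdd]) (use that in \<open>auto simp: S_def\<close>)
    then show ?thesis using that by (simp add: field_simps)
  qed
  have "0 \<le> m" unfolding m_def using ne nn by (rule cInf_greatest)
  moreover have "m * (h - s) \<le> chord s" using le[of h] s chord_nonneg[of h] by simp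
  moreover have "chord x \<le> chord s + m * (s - \<bar>x\<bar>)" if x: "\<bar>x\<bar> \<le> h" for x
  proof -
    consider "\<bar>x\<bar> > s" | "\<bar>x\<bar> = s" | "\<bar>x\<bar> < s" by linarith
    then show ?thesis
    proof cases
      case 1
      have "m * (\<bar>x\<bar> - s) = - (m * (s - \<bar>x\<bar>))" by (simp add: algebra_simps)
      then show ?thesis using le[OF 1 x] by (simp add: chord_even)
    next
      case 2 then show ?thesis using chord_even(2)[of x] by simp
    next
      case 3
      \<comment> \<open>To the left of \<open>s\<close>: by concavity at the three points
        \<open>\<bar>x\<bar> < s < t\<close>, the quotient on the left is at most every quotient on
        the right, hence at most their infimum.\<close>
      have "(chord \<bar>x\<bar> - chord s) / (s - \<bar>x\<bar>) \<le> m" unfolding m_def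
      proof (rule cInf_greatest[OF ne])
        fix z assume "z \<in> S"
        then obtain t where t: "s < t" "t \<le> h" "z = (chord s - chord t) / (t - s)" by (auto simp: S_def)
        let ?d = "t - \<bar>x\<bar>"
        have "((t - s) / ?d) * chord \<bar>x\<bar> + ((s - \<bar>x\<bar>) / ?d) * chord t \<le> chord (((t - s) / ?d) * \<bar>x\<bar> + ((s - \<bar>x\<bar>) / ?d) * t)"
          by (rule chord_concave) (use t 3 s x in \<open>auto simp flip: add_divide_distrib\<close>)
        also have "((t - s) / ?d) * \<bar>x\<bar> + ((s - \<bar>x\<bar>) / ?d) * t = s"
        proof -
          have "?d \<noteq> 0" using t 3 by linarith
          moreover have "(t - s) * \<bar>x\<bar> + (s - \<bar>x\<bar>) * t = s * ?d" by (simp add: algebra_simps)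
          ultimately show ?thesis by (simp flip: add_divide_distrib)
        qed
        finally have "((t - s) * chord \<bar>x\<bar> + (s - \<bar>x\<bar>) * chord t) / ?d \<le> chord s"
          by (simp add: add_divide_distrib)
        moreover have "0 < ?d" using t 3 by linarith
        ultimately have "(t - s) * chord \<bar>x\<bar> + (s - \<bar>x\<bar>) * chord t \<le> chord s * ?d"
          by (simp only: pos_divide_le_eq)
        then have "(chord \<bar>x\<bar> - chord s) * (t - s) \<le> (chord s - chord t) * (s - \<bar>x\<bar>)"
          by (simp add: algebra_simps)
        then show "(chord \<bar>x\<bar> - chord s) / (s - \<bar>x\<bar>) \<le> z"
          using t(1) 3 unfolding t(3) by (simp add: pos_divide_le_eq pos_le_divide_eq)
      qed
      then have "chord \<bar>x\<bar> - chord s \<le> m * (s - \<bar>x\<bar>)" using 3 by (simp add: divide_le_eq)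
      then show ?thesis using chord_even(2)[of x] by simp
    qed
  qed
  ultimately show thesis by (rule that)
qed

lemma area_le_chord_integral:
  assumes "\<And>x. \<bar>x\<bar> \<le> h \<Longrightarrow> chord x \<le> B x" "(B has_integral I) {-h..h}"
  shows "emeasure lborel C \<le> ennreal I"
proof (rule area_le_integral[OF borel_C _ _ _ assms(2)])
  show "- h \<le> x \<and> x \<le> h" if "(x, y) \<in> C" for x y
    using fst_le[OF that] fst_ge[OF that] by simp
  fix x assume "- h \<le> x" "x \<le> h"
  then have x: "\<bar>x\<bar> \<le> h" by simp
  show "0 \<le> B x" using assms(1)[OF x] chord_nonneg[OF x] by simp
  show "emeasure lborel {y. (x, y) \<in> C} \<le> ennreal (B x)"
    using emeasure_slice[OF x] assms(1)[OF x] by (simp add: ennreal_leI)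
qed

lemma not_interior_supporting:
  assumes "z \<notin> interior C"
  obtains a where "a \<noteq> 0" "\<And>x. x \<in> C \<Longrightarrow> a \<bullet> x \<le> a \<bullet> z"
proof -
  have "convex (interior C)" using convex_C by (rule convex_interior)
  then obtain a b where a: "a \<noteq> 0" "\<forall>x\<in>interior C. a \<bullet> x \<le> b" "\<forall>x\<in>{z}. b \<le> a \<bullet> x"
    using separating_hyperplane_sets[of "interior C" "{z}"] interior_C assms by auto
  have "closed {x. a \<bullet> x \<le> b}" by (rule closed_halfspace_le)
  then have "closure (interior C) \<subseteq> {x. a \<bullet> x \<le> b}" using a by (intro closure_minimal) auto
  then have "a \<bullet> x \<le> a \<bullet> z" if "x \<in> C" for x
    using that convex_closure_interior[OF convex_C interior_C] closure_subset[of C] a(3) by force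
  then show thesis using that a(1) by blast
qed

text \<open>A supporting line at the point would have a normal with vanishing second component, as
  \<open>C\<close> has points vertically above and below, and then a vanishing first component, as
  the touching points lie strictly to the right and to the left.\<close>

lemma between_interior:
  assumes "\<bar>x\<bar> < h" "- roof (- x) < y" "y < roof x"
  shows "(x, y) \<in> interior C"
proof (rule ccontr)
  assume "(x, y) \<notin> interior C"
  then obtain a where a: "a \<noteq> 0" "\<And>z. z \<in> C \<Longrightarrow> a \<bullet> z \<le> a \<bullet> (x, y)" using not_interior_supporting by blast
  have x: "\<bar>x\<bar> \<le> h" using assms by simp
  have "snd a * roof x \<le> snd a * y" "snd a * (- roof (- x)) \<le> snd a * y"
    using a(2)[OF roof_mem[OF x]] a(2)[OF floor_mem[OF x]] by (auto simp: inner_prod_def)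
  then have "snd a = 0" using assms(2,3)
    by (metis less_le_not_le linorder_neqE_linordered_idom mult_less_cancel_left_neg mult_less_cancel_left_pos)
  obtain p where p: "p \<in> C" "fst p = h" using fst_att by blast
  have "fst a * h \<le> fst a * x" "fst a * (-h) \<le> fst a * x"
    using a(2)[OF p(1)] a(2)[OF sym_C[OF p(1)]] p \<open>snd a = 0\<close> by (auto simp: inner_prod_def)
  moreover have "-h < x" "x < h" using assms(1) by auto
  ultimately have "fst a = 0"
    by (metis less_le_not_le linorder_neqE_linordered_idom mult_less_cancel_left_neg mult_less_cancel_left_pos)
  then show False using \<open>snd a = 0\<close> a(1) by (simp add: prod_eq_iff)
qed

end

section \<open>Lattice-free bodies \<open>c + C\<close> of lattice direction width
  \<open>2 * h > 1\<close>\<close>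

locale lattice_free_slab = slab_body +
  fixes c :: "real \<times> real"
  assumes h_half: "1 / 2 < h" and free: "(of_int i, of_int j) - c \<notin> interior C"
begin

definition line_dist :: real where "line_dist = \<bar>of_int (round (fst c)) - fst c\<bar>"

lemma line_dist_bounds: "0 \<le> line_dist" "line_dist \<le> 1 / 2" "line_dist < h"
  using of_int_round_abs_le[of "fst c"] h_half by (auto simp: line_dist_def)

lemma chord_le_1: "chord line_dist \<le> 1"
proof (rule ccontr)
  assume "\<not> chord line_dist \<le> 1"
  define x where "x = of_int (round (fst c)) - fst c"
  have x: "\<bar>x\<bar> < h" using line_dist_bounds by (simp add: x_def line_dist_def)
  have "chord x > 1" using \<open>\<not> chord line_dist \<le> 1\<close> chord_even(2)[of x] by (simp add: line_dist_def x_def)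
  then have len: "roof x + roof (- x) > 1" by (simp add: chord_def)
  \<comment> \<open>The first integer strictly above the lower end of the chord; it exceeds that end
    by at most 1, so it is strictly below the upper end as well.\<close>
  define j where "j = \<lfloor>snd c - roof (- x)\<rfloor> + 1"
  have "- roof (- x) < j - snd c" "j - snd c \<le> 1 - roof (- x)" unfolding j_def by linarith+
  then have "(x, j - snd c) \<in> interior C" using len x by (intro between_interior) auto
  then show False using free[of "round (fst c)" j] by (simp add: x_def minus_prod_def)
qed

lemma area_le_tent:
  assumes "\<And>x. \<bar>x\<bar> \<le> h \<Longrightarrow> chord x \<le> chord line_dist + m * (line_dist - \<bar>x\<bar>)"
  shows "emeasure lborel C \<le> ennreal (2 * h * chord line_dist + m * (2 * h * line_dist - h\<^sup>2))"
proof -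
  have "emeasure lborel C \<le> ennreal (2 * h * (chord line_dist + m * line_dist) - m * h\<^sup>2)"
    by (rule area_le_chord_integral[OF _ has_integral_tent]) (use assms h_pos in \<open>auto simp: algebra_simps\<close>)
  then show ?thesis by (simp add: algebra_simps)
qed

text \<open>The tent integral depends on the slope through
  \<open>m * h * (2 * line_dist - h)\<close>, which is not positive here. So the constant majorant,
  with value at most 1, is the worst case.\<close>

lemma area_le_flat:
  assumes "2 * line_dist \<le> h"
  shows "emeasure lborel C \<le> ennreal (2 * h)"
proof -
  obtain m where m: "0 \<le> m" "\<And>x. \<bar>x\<bar> \<le> h \<Longrightarrow> chord x \<le> chord line_dist + m * (line_dist - \<bar>x\<bar>)"
    using chord_support[OF line_dist_bounds(1,3)] by metis
  have "h * (2 * line_dist - h) \<le> 0" using assms h_pos by (simp add: mult_nonneg_nonpos)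
  then have "m * (h * (2 * line_dist - h)) \<le> 0" using m(1) by (simp add: mult_nonneg_nonpos)
  moreover have "h * chord line_dist \<le> h * 1" using chord_le_1 h_pos by (intro mult_left_mono) auto
  ultimately have "2 * h * chord line_dist + m * (2 * h * line_dist - h\<^sup>2) \<le> 2 * h"
    by (simp add: power2_eq_square algebra_simps)
  then show ?thesis using area_le_tent[OF m(2)] ennreal_leI order_trans by blast
qed

lemma area_le_2h: "1 \<le> h \<Longrightarrow> emeasure lborel C \<le> ennreal (2 * h)"
  using area_le_flat line_dist_bounds by simp

text \<open>With \<open>w = 2 * h\<close> this is \<open>w^2 / (2 * (w - 1))\<close>. It is the
  integral of the tent that vanishes at \<open>h\<close> and has value 1 at 1/2.\<close>

definition bound :: real where "bound = h\<^sup>2 / (h - 1 / 2)"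

lemma bound_pos: "0 < bound"
  using h_half by (simp add: bound_def)

lemma flat_le_bound: "h \<le> 1 \<Longrightarrow> 2 * h \<le> bound" and flat_less_bound: "h < 1 \<Longrightarrow> 2 * h < bound"
proof -
  have *: "bound - 2 * h = h * (1 - h) / (h - 1/2)"
    using h_half by (simp add: bound_def field_simps power2_eq_square)
  have "h \<le> 1 \<Longrightarrow> 0 \<le> h * (1 - h) / (h - 1/2)" "h < 1 \<Longrightarrow> 0 < h * (1 - h) / (h - 1/2)"
    using h_half by (auto intro!: divide_nonneg_pos divide_pos_pos mult_pos_pos)
  then show "h \<le> 1 \<Longrightarrow> 2 * h \<le> bound" "h < 1 \<Longrightarrow> 2 * h < bound" using * by auto
qed

text \<open>Here the tent integral increases with the slope, so the worst case is the steepest tent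
  allowed, vanishing at \<open>h\<close>. Its integral
  \<open>chord line_dist * h^2 / (h - line_dist)\<close> grows up to \<open>bound\<close> when the
  chord is 1 and the distance 1/2, and equality needs all three extremes at once.\<close>

lemma steep_bound:
  assumes m: "0 \<le> m" "m * (h - line_dist) \<le> chord line_dist" and hs: "h < 2 * line_dist"
  shows "2 * h * chord line_dist + m * (2 * h * line_dist - h\<^sup>2) \<le> bound"
    and "2 * h * chord line_dist + m * (2 * h * line_dist - h\<^sup>2) = bound \<Longrightarrow> line_dist = 1 / 2 \<and> chord line_dist = 1 \<and> m * (h - line_dist) = chord line_dist"
proof -
  let ?E = "2 * h * chord line_dist + m * (2 * h * line_dist - h\<^sup>2)"
  have d: "0 < h - line_dist" "0 < h - 1 / 2" using line_dist_bounds h_half by auto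
  have p: "0 < h * (2 * line_dist - h)" using h_pos hs by simp
  \<comment> \<open>After multiplication by \<open>h - line_dist\<close> the losses separate:
    \<open>slack\<close> for a slope that is not maximal, \<open>ch\<close> for a chord below 1,
    \<open>bs\<close> for a distance below 1/2.\<close>
  have E: "?E * (h - line_dist) = chord line_dist * h\<^sup>2 - (chord line_dist - m * (h - line_dist)) * (h * (2 * line_dist - h))"
    by (simp add: power2_eq_square algebra_simps)
  have b: "bound * (h - 1 / 2) = h\<^sup>2" using d by (simp add: bound_def)
  have slack: "0 \<le> (chord line_dist - m * (h - line_dist)) * (h * (2 * line_dist - h))" using m p by (intro mult_nonneg_nonneg[OF _ less_imp_le]) auto
  have ch: "chord line_dist * h\<^sup>2 \<le> 1 * h\<^sup>2" using chord_le_1 by (intro mult_right_mono) auto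
  have bs: "bound * (h - 1 / 2) \<le> bound * (h - line_dist)" using bound_pos line_dist_bounds by (intro mult_left_mono) auto
  have "?E * (h - line_dist) \<le> bound * (h - line_dist)" using E slack ch bs b by linarith
  then show "?E \<le> bound" using d by simp
  assume eq: "?E = bound"
  then have eqs: "chord line_dist * h\<^sup>2 = h\<^sup>2" "(chord line_dist - m * (h - line_dist)) * (h * (2 * line_dist - h)) = 0"
      "bound * (h - 1 / 2) = bound * (h - line_dist)"
    using E slack ch bs b unfolding eq by linarith+
  have "chord line_dist = 1" using eqs(1) h_pos by simp
  moreover have "line_dist = 1 / 2" using eqs(3) bound_pos by simp
  moreover have "m * (h - line_dist) = chord line_dist" using eqs(2) p by (metis eq_iff_diff_eq_0 less_irrefl mult_eq_0_iff)
  ultimately show "line_dist = 1 / 2 \<and> chord line_dist = 1 \<and> m * (h - line_dist) = chord line_dist" by blast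
qed

lemma area_le_bound:
  assumes "h \<le> 1"
  shows "emeasure lborel C \<le> ennreal bound"
proof (cases "2 * line_dist \<le> h")
  case True
  then show ?thesis using area_le_flat flat_le_bound[OF assms] ennreal_leI order_trans by blast
next
  case False
  obtain m where m: "0 \<le> m" "m * (h - line_dist) \<le> chord line_dist" "\<And>x. \<bar>x\<bar> \<le> h \<Longrightarrow> chord x \<le> chord line_dist + m * (line_dist - \<bar>x\<bar>)"
    using chord_support[OF line_dist_bounds(1,3)] by metis
  then show ?thesis
    using area_le_tent[OF m(3)] steep_bound(1)[OF m(1,2)] False ennreal_leI order_trans by (metis not_le)
qed

text \<open>For \<open>h < 1\<close> the flat bound is strictly smaller than \<open>bound\<close>,
  so equality occurs only in the steep case. There all losses vanish and the supporting line becomes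
  the extremal tent.\<close>

lemma equality_tent:
  assumes "h < 1" "emeasure lborel C = ennreal bound"
  shows "line_dist = 1 / 2" "\<bar>x\<bar> \<le> h \<Longrightarrow> chord x \<le> (h - \<bar>x\<bar>) / (h - 1 / 2)"
proof -
  have False if "2 * line_dist \<le> h"
    using area_le_flat[OF that] flat_less_bound[OF assms(1)] assms(2) h_pos by (simp add: ennreal_le_iff)
  then have hs: "h < 2 * line_dist" by force
  obtain m where m: "0 \<le> m" "m * (h - line_dist) \<le> chord line_dist" "\<And>x. \<bar>x\<bar> \<le> h \<Longrightarrow> chord x \<le> chord line_dist + m * (line_dist - \<bar>x\<bar>)"
    using chord_support[OF line_dist_bounds(1,3)] by metis
  let ?E = "2 * h * chord line_dist + m * (2 * h * line_dist - h\<^sup>2)"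
  have "ennreal bound \<le> ennreal ?E" using area_le_tent[OF m(3)] assms(2) by simp
  then have "bound \<le> ?E" using bound_pos by (auto simp: ennreal_le_iff2)
  then have s: "line_dist = 1 / 2" "chord line_dist = 1" "m * (h - line_dist) = 1"
    using steep_bound[OF m(1,2) hs] by auto
  show "line_dist = 1 / 2" by fact
  assume x: "\<bar>x\<bar> \<le> h"
  have "m * (h - 1 / 2) = 1" using s(3) unfolding s(1) .
  then have m': "m = 1 / (h - 1 / 2)" using h_half by (simp add: eq_divide_eq)
  have "chord x \<le> 1 + m * (1 / 2 - \<bar>x\<bar>)" using m(3)[OF x] unfolding s(2) unfolding s(1) .
  also have "\<dots> = (h - \<bar>x\<bar>) / (h - 1 / 2)" unfolding m' using h_half by (simp add: field_simps)
  finally show "chord x \<le> (h - \<bar>x\<bar>) / (h - 1 / 2)" .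
qed

text \<open>If the central chord were shorter than the apex of the tent, then every chord would be, and
  cutting off the tip of the tent would give a smaller upper bound for the area.\<close>

lemma equality_central_chord:
  assumes "h < 1" "emeasure lborel C = ennreal bound"
  shows "chord 0 = h / (h - 1 / 2)"
proof (rule ccontr)
  assume ne: "chord 0 \<noteq> h / (h - 1 / 2)"
  define k where "k = h - 1 / 2"
  have k: "0 < k" using h_half by (simp add: k_def)
  define M where "M = chord 0"
  have M: "M < h / k" using equality_tent(2)[OF assms, of 0] ne h_pos by (simp add: M_def k_def)
  have M0: "0 \<le> M" using chord_nonneg[of 0] h_pos by (simp add: M_def)
  \<comment> \<open>The tent \<open>(h - \<bar>x\<bar>) / k\<close> exceeds \<open>M\<close> exactly
    for \<open>\<bar>x\<bar> < \<delta>\<close>; this is the half-width of the tip.\<close>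
  define \<delta> where "\<delta> = h - M * k"
  have \<delta>: "0 < \<delta>" "\<delta> \<le> h" using M M0 k by (auto simp: \<delta>_def field_simps)
  let ?T = "\<lambda>x. h / k - 1 / k * \<bar>x\<bar>"
  \<comment> \<open>\<open>?D\<close> is the height of the tent above \<open>M\<close> on the tip;
    cutting it off costs the area \<open>\<delta>^2 / k\<close>.\<close>
  let ?D = "\<lambda>x. \<delta> / k - 1 / k * \<bar>x\<bar>"
  let ?B = "\<lambda>x. ?T x - (if x \<in> {-\<delta>..\<delta>} then ?D x else 0)"
  have "((\<lambda>x. if x \<in> {-\<delta>..\<delta>} then ?D x else 0) has_integral (2 * \<delta> * (\<delta> / k) - 1 / k * \<delta>\<^sup>2)) {-h..h}"
    using has_integral_restrict[of "{-\<delta>..\<delta>}" "{-h..h}" ?D] has_integral_tent[of \<delta> "\<delta> / k" "1 / k"] \<delta> by simp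
  then have "(?B has_integral ((2 * h * (h / k) - 1 / k * h\<^sup>2) - (2 * \<delta> * (\<delta> / k) - 1 / k * \<delta>\<^sup>2))) {-h..h}"
    using h_pos by (intro has_integral_diff has_integral_tent) auto
  moreover have "chord x \<le> ?B x" if x: "\<bar>x\<bar> \<le> h" for x
  proof (cases "x \<in> {-\<delta>..\<delta>}")
    case True
    have "chord x \<le> M" using chord_antimono[of 0 "\<bar>x\<bar>"] x chord_even(2)[of x] by (simp add: M_def)
    also have "M = h / k - \<delta> / k" using k by (simp add: \<delta>_def diff_divide_distrib)
    finally show ?thesis using True by simp
  next
    case False
    then have "?B x = ?T x" by (simp only: if_False diff_0_right)
    then show ?thesis using equality_tent(2)[OF assms x] by (simp add: k_def[symmetric] diff_divide_distrib)
  qed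
  ultimately have "emeasure lborel C \<le> ennreal ((2 * h * (h / k) - 1 / k * h\<^sup>2) - (2 * \<delta> * (\<delta> / k) - 1 / k * \<delta>\<^sup>2))"
    by (intro area_le_chord_integral)
  also have "(2 * h * (h / k) - 1 / k * h\<^sup>2) - (2 * \<delta> * (\<delta> / k) - 1 / k * \<delta>\<^sup>2) = bound - \<delta>\<^sup>2 / k"
    by (simp add: bound_def k_def[symmetric] power2_eq_square)
  finally have "bound \<le> bound - \<delta>\<^sup>2 / k" using assms(2) bound_pos by (auto simp: ennreal_le_iff2)
  then show False using \<delta> k by (auto simp: divide_le_0_iff)
qed

text \<open>The central chord ends at \<open>(0, g)\<close>, and the cross of this point with the
  touching point \<open>p\<close> already has area \<open>bound\<close>, so it is \<open>C\<close>.
  Both lattice lines next to the centre have distance 1/2, and lattice-freeness makes the midpoints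
  of their chords half-integral. The difference of these midpoints is the slope
  \<open>\<mu>\<close>, which is thus an integer and can be sheared away.\<close>

lemma equality_shape:
  assumes h1: "h < 1" and eq: "emeasure lborel C = ennreal bound"
  obtains k :: int where
    "int_lin 1 0 (-k) 1 ` C = convex hull {(h, 0), -(h, 0), (0, h / (2*h - 1)), -(0, h / (2*h - 1))}"
    "int_lin 1 0 (-k) 1 c - (1/2, 1/2) \<in> Z2"
proof -
  define g where "g = h / (2 * h - 1)"
  have g: "0 < g" using h_half by (simp add: g_def)
  have gb: "2 * (h * g) = bound" using h_half by (simp add: g_def bound_def field_simps power2_eq_square)
  have "roof 0 = g" using equality_central_chord[OF assms] h_half by (simp add: chord_def g_def field_simps)
  then have q: "(0, g) \<in> C" using roof_mem[of 0] h_pos by simp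
  obtain p where p: "p \<in> C" "fst p = h" using fst_att by blast
  define \<mu> where "\<mu> = snd p / h"
  have pe: "p = (h, \<mu> * h)" using p h_pos by (simp add: \<mu>_def prod_eq_iff)
  have "det2 p (0, g) = h * g" by (simp add: pe det2_def)
  moreover have "h * g > 0" using g h_pos by simp
  ultimately have C: "C = convex hull {(h, \<mu> * h), -(h, \<mu> * h), (0, g), -(0, g)}"
    using eq_cross[OF p(1) q] eq gb unfolding pe by force
  have far: "1 / 2 \<le> \<bar>(of_int j - snd c) - \<mu> * x\<bar>" if x: "x = of_int i - fst c" "\<bar>x\<bar> = 1 / 2" for i j x
  proof (rule ccontr)
    assume "\<not> ?thesis"
    then have "\<bar>(of_int j - snd c) - \<mu> * x\<bar> / g < (1 / 2) / g" using g by (intro divide_strict_right_mono) auto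
    \<comment> \<open>At horizontal distance 1/2 from the centre the vertical chord of the cross has
      half-length exactly 1/2.\<close>
    also have "(1 / 2) / g = 1 - (1 / 2) / h" using h_half by (simp add: g_def field_simps)
    finally have "\<bar>x\<bar> / h + \<bar>(of_int j - snd c) - \<mu> * x\<bar> / g < 1" unfolding x(2) by linarith
    then have "(x, of_int j - snd c) \<in> interior C" unfolding C using h_pos g by (intro mem_interior_cross) auto
    then show False using free[of i j] x by (simp add: minus_prod_def)
  qed
  have half: "z - 1 / 2 \<in> \<int>" if "\<And>j::int. 1 / 2 \<le> \<bar>of_int j - z\<bar>" for z :: real
  proof -
    have "\<bar>of_int (round z) - z\<bar> = 1 / 2" using that[of "round z"] of_int_round_abs_le[of z] by linarith
    then have "z - 1 / 2 = of_int (round z) \<or> z - 1 / 2 = of_int (round z - 1)" by (auto simp: abs_if split: if_splits)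
    then show ?thesis by (metis Ints_of_int)
  qed
  have c1: "\<bar>of_int (round (fst c)) - fst c\<bar> = 1 / 2" using equality_tent(1)[OF assms] by (simp add: line_dist_def)
  then obtain i :: int where i: "of_int i - fst c = 1 / 2"
  proof (cases "of_int (round (fst c)) \<ge> fst c")
    case False
    then show ?thesis using that[of "round (fst c) + 1"] c1 by simp
  qed (use c1 that[of "round (fst c)"] in simp)
  \<comment> \<open>The midpoints of the two chords have heights \<open>snd c + \<mu> / 2\<close>
    and \<open>snd c - \<mu> / 2\<close>; no integer is closer to them than 1/2.\<close>
  have "1 / 2 \<le> \<bar>of_int j - (snd c + \<mu> / 2)\<bar>" for j using far[of "1 / 2" i j] i by (simp add: algebra_simps)
  then have u: "snd c + \<mu> / 2 - 1 / 2 \<in> \<int>" by (rule half)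
  have "1 / 2 \<le> \<bar>of_int j - (snd c - \<mu> / 2)\<bar>" for j using far[of "- 1 / 2" "i - 1" j] i by (simp add: algebra_simps)
  then have l: "snd c - \<mu> / 2 - 1 / 2 \<in> \<int>" by (rule half)
  have "\<mu> = (snd c + \<mu> / 2 - 1 / 2) - (snd c - \<mu> / 2 - 1 / 2)" by simp
  then have "\<mu> \<in> \<int>" using u l Ints_diff by metis
  then obtain k :: int where k: "\<mu> = k" by (auto elim: Ints_cases)
  have "int_lin 1 0 (-k) 1 ` C = convex hull {(h, 0), -(h, 0), (0, g), -(0, g)}"
    unfolding C convex_hull_linear_image[OF linear_lin] by (simp add: lin_def k)
  moreover have "int_lin 1 0 (-k) 1 c - (1/2, 1/2) \<in> Z2"
  proof -
    have fc: "fst c = i - 1 / 2" using i by simp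
    have "int_lin 1 0 (-k) 1 c - (1/2, 1/2) = (of_int (i - 1), (snd c + \<mu> / 2 - 1 / 2) - of_int (k * i))"
      by (simp add: lin_def k fc algebra_simps)
    then show ?thesis using u by (auto simp: Z2_def)
  qed
  ultimately show thesis using that g_def by blast
qed

end

section \<open>Unbounded sets\<close>

text \<open>Averaging a ball around \<open>z\<close> with its reflection around \<open>-z\<close>
  gives a ball of the same radius around 0.\<close>

lemma sym_convex_cball:
  assumes "convex C" "interior C \<noteq> {}" and sym: "\<And>x. x \<in> C \<Longrightarrow> -x \<in> C"
  obtains r where "0 < r" "cball 0 r \<subseteq> (C :: 'a::real_normed_vector set)"
proof -
  obtain z r where zr: "0 < r" "cball z r \<subseteq> C"
    using assms(2) by (meson ex_in_conv mem_interior_cball)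
  have "y \<in> C" if "norm y \<le> r" for y
  proof -
    have "z + y \<in> cball z r" "z - y \<in> cball z r" using that by (auto simp: dist_norm)
    then have 1: "z + y \<in> C" "- (z - y) \<in> C" using zr sym by blast+
    have "(1/2) *\<^sub>R (z + y) + (1/2) *\<^sub>R (- (z - y)) \<in> C" by (rule convexD[OF assms(1) 1]) auto
    moreover have "(1/2) *\<^sub>R (z + y) + (1/2) *\<^sub>R (- (z - y)) = y" by (simp flip: scaleR_right_distrib scaleR_2)
    ultimately show ?thesis by simp
  qed
  then show thesis using that zr(1) by (auto simp: subset_iff)
qed

text \<open>A far point \<open>x\<close> and an orthogonal vector of fixed length \<open>r\<close>
  span a cross of area \<open>2 * r * norm x\<close> inside \<open>C\<close>, and
  \<open>norm x\<close> is arbitrarily large.\<close>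

lemma unbounded_area:
  fixes C :: "(real \<times> real) set"
  assumes "closed C" "convex C" "interior C \<noteq> {}" "\<And>x. x \<in> C \<Longrightarrow> -x \<in> C" and unb: "\<not> bounded C"
  shows "emeasure lborel C = \<infinity>"
proof -
  obtain r where r: "0 < r" "cball 0 r \<subseteq> C" using sym_convex_cball assms by blast
  have "of_nat n \<le> emeasure lborel C" for n :: nat
  proof -
    have "\<not> (\<forall>x\<in>C. norm x \<le> n / r + 1)" using unb unfolding bounded_iff by blast
    then obtain x where x: "x \<in> C" "norm x > n / r + 1" by force
    have nx: "norm x > 0" using x(2) r(1) by (smt (verit) divide_nonneg_pos of_nat_0_le_iff)
    \<comment> \<open>\<open>x\<close> rotated by a right angle and rescaled to length
      \<open>r\<close>.\<close>
    define y where "y = (- snd x * (r / norm x), fst x * (r / norm x))"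
    have nn: "norm x * norm x = fst x * fst x + snd x * snd x"
      by (simp add: norm_prod_def power2_eq_square[symmetric])
    have "norm y = norm ((r / norm x) *\<^sub>R (- snd x, fst x))" by (simp add: y_def mult.commute)
    also have "\<dots> = \<bar>r / norm x\<bar> * norm (- snd x, fst x)" by (rule norm_scaleR)
    also have "norm (- snd x, fst x) = norm x" by (simp add: norm_prod_def add.commute)
    also have "\<bar>r / norm x\<bar> * norm x = r" using nx r by simp
    finally have "y \<in> cball 0 r" by simp
    then have y: "y \<in> C" using r by blast
    have "det2 x y = (r / norm x) * (norm x * norm x)" unfolding nn by (simp add: det2_def y_def algebra_simps)
    then have det: "det2 x y = r * norm x" using nx by simp
    then have dpos: "det2 x y > 0" using r nx by simp
    have "real n \<le> r * norm x" using x(2) r(1) by (simp add: field_simps)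
    then have "ennreal (real n) \<le> ennreal (2 * \<bar>det2 x y\<bar>)" using det dpos by (intro ennreal_leI) auto
    also have "\<dots> = emeasure lborel (convex hull {x, -x, y, -y})" using area_cross dpos by simp
    also have "\<dots> \<le> emeasure lborel C"
      using x y assms by (intro emeasure_mono hull_minimal) auto
    finally show ?thesis by (simp add: ennreal_of_nat_eq_real_of_nat)
  qed
  then show ?thesis by (metis ennreal_SUP_of_nat_eq_top SUP_least infinity_ennreal_def top.extremum_unique)
qed

text \<open>Normalised points of \<open>C\<close> tending to infinity have a limit direction
  \<open>v\<close>. Closedness and convexity put the ray from 0 in direction \<open>v\<close> into
  \<open>C\<close>, symmetry the whole line, and convexity with closedness its translates through
  points of \<open>C\<close>.\<close>

lemma unbounded_direction:
  fixes C :: "'a::euclidean_space set"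
  assumes cl: "closed C" and cv: "convex C" and z: "0 \<in> C" and sym: "\<And>x. x \<in> C \<Longrightarrow> -x \<in> C"
    and unb: "\<not> bounded C"
  obtains v where "norm v = 1" "\<And>x t. x \<in> C \<Longrightarrow> x + t *\<^sub>R v \<in> C"
proof -
  have "\<exists>x\<in>C. norm x > real n + 1" for n using unb unfolding bounded_iff by (meson not_le)
  then obtain X where X: "\<And>n. X n \<in> C" "\<And>n. norm (X n) > real n + 1" by metis
  have Xp: "norm (X n) > 0" for n using X(2)[of n] by linarith
  define V where "V n = X n /\<^sub>R norm (X n)" for n
  have "V n \<in> sphere 0 1" for n using Xp[of n] by (auto simp: V_def)
  then obtain v \<sigma> where v: "v \<in> sphere 0 1" "strict_mono \<sigma>" "(V \<circ> \<sigma>) \<longlonglongrightarrow> v"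
    using compact_sphere[of 0 1] unfolding compact_def by metis
  have ray: "t *\<^sub>R v \<in> C" if "0 \<le> t" for t
  proof -
    \<comment> \<open>Skipping the first \<open>N\<close> terms ensures
      \<open>t \<le> norm (X ?m)\<close>, so that the approximating points lie on segments from 0 to
      points of \<open>C\<close>.\<close>
    obtain N :: nat where N: "t \<le> N" using real_arch_simple by blast
    show ?thesis
    proof (rule closed_sequentially[OF cl])
      show "(\<lambda>n. t *\<^sub>R (V \<circ> \<sigma>) (n + N)) \<longlonglongrightarrow> t *\<^sub>R v"
        by (intro tendsto_intros LIMSEQ_ignore_initial_segment v)
      fix n
      let ?m = "\<sigma> (n + N)"
      have "n + N \<le> ?m" using v(2) by (simp add: strict_mono_imp_increasing)
      then have "t \<le> norm (X ?m)" using X(2)[of ?m] N by linarith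
      then have "0 \<le> t / norm (X ?m)" "t / norm (X ?m) \<le> 1" using that Xp[of ?m] by auto
      then have "(t / norm (X ?m)) *\<^sub>R X ?m + (1 - t / norm (X ?m)) *\<^sub>R 0 \<in> C"
        by (intro convexD[OF cv X(1) z]) auto
      then show "t *\<^sub>R (V \<circ> \<sigma>) (n + N) \<in> C" by (simp add: V_def divide_inverse)
    qed
  qed
  have line: "t *\<^sub>R v \<in> C" for t
    using ray[of t] sym[OF ray[of "-t"]] by (cases "0 \<le> t") auto
  \<comment> \<open>The points \<open>(1 - e) x + e ((t/e) v)\<close> are in \<open>C\<close> and
    tend to \<open>x + t v\<close> as \<open>e\<close> tends to 0.\<close>
  have "x + t *\<^sub>R v \<in> C" if "x \<in> C" for x t
  proof (rule closed_sequentially[OF cl])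
    have "(\<lambda>n. x - inverse (real (Suc n)) *\<^sub>R x + t *\<^sub>R v) \<longlonglongrightarrow> x - 0 *\<^sub>R x + t *\<^sub>R v"
      by (intro tendsto_intros LIMSEQ_inverse_real_of_nat)
    then show "(\<lambda>n. x - inverse (real (Suc n)) *\<^sub>R x + t *\<^sub>R v) \<longlonglongrightarrow> x + t *\<^sub>R v" by simp
    fix n
    let ?e = "inverse (real (Suc n))"
    have "(1 - ?e) *\<^sub>R x + ?e *\<^sub>R ((real (Suc n) * t) *\<^sub>R v) \<in> C"
      by (rule convexD[OF cv that line]) (auto simp: field_simps)
    moreover have "?e * (real (Suc n) * t) = t" by (simp add: field_simps)
    ultimately show "x - ?e *\<^sub>R x + t *\<^sub>R v \<in> C" by (simp add: scaleR_left_diff_distrib del: of_nat_Suc)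
  qed
  then show thesis using that v(1) by simp
qed

text \<open>Once the invariant direction \<open>v\<close> is annihilated by a primitive integer
  functional \<open>U\<close>, every lattice line of \<open>U\<close> consists of translates along
  \<open>v\<close> and contains a lattice point. So \<open>U\<close> avoids all integers on the
  interior of \<open>K\<close> and, by connectedness, stays between two consecutive ones.\<close>

lemma unbounded_subset_split:
  fixes K :: "(real \<times> real) set"
  assumes cl: "closed K" and cv: "convex K" and ne: "interior K \<noteq> {}"
    and sym: "\<And>x. x \<in> K \<Longrightarrow> 2 *\<^sub>R c - x \<in> K" and free: "interior K \<inter> Z2 = {}" and unb: "\<not> bounded K"
  shows "emeasure lborel K = \<infinity>" "\<exists>S. is_split S \<and> K \<subseteq> S"
proof -
  define C where "C = (+) (-c) ` K"
  have K: "K = (+) c ` C" by (simp add: C_def image_comp o_def)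
  have C: "closed C" "convex C" "interior C \<noteq> {}"
    using closed_translation[OF cl, of "-c"] convex_translation[OF cv, of "-c"] interior_translation[of "-c" K] ne
    unfolding C_def by simp_all
  have "\<not> bounded C" using unb bounded_translation[of C c] K by metis
  note C = C this
  have symC: "-x \<in> C" if "x \<in> C" for x
  proof -
    have "2 *\<^sub>R c - (c + x) \<in> K" using that K by (intro sym) auto
    then show ?thesis unfolding C_def by (intro image_eqI[of _ _ "2 *\<^sub>R c - (c + x)"]) (auto simp: scaleR_2)
  qed
  have "emeasure lborel C = \<infinity>" by (rule unbounded_area[OF C(1-3) symC C(4)])
  then show "emeasure lborel K = \<infinity>" unfolding K using emeasure_lborel_translate[of C c] C(1) by simp
  obtain r where r: "0 < r" "cball 0 r \<subseteq> C" using sym_convex_cball[OF C(2,3) symC] by blast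
  then have "0 \<in> C" by auto
  obtain v where v: "norm v = 1" "\<And>x t. x \<in> C \<Longrightarrow> x + t *\<^sub>R v \<in> C"
    using unbounded_direction[OF C(1,2) \<open>0 \<in> C\<close> symC C(4)] by blast
  have shift: "x + t *\<^sub>R v \<in> interior K" if "x \<in> interior K" for x t
  proof -
    have "(+) (t *\<^sub>R v) ` K \<subseteq> K" unfolding K using v(2) by (force simp: add.commute add.assoc)
    then have "interior ((+) (t *\<^sub>R v) ` K) \<subseteq> interior K" by (rule interior_mono)
    then have "t *\<^sub>R v + x \<in> interior K" unfolding interior_translation using that by blast
    then show ?thesis by (simp add: add.commute)
  qed
  have v0: "v \<noteq> 0" using v(1) by auto
  obtain a b :: int where ab: "coprime a b" "a * fst v + b * snd v = 0"
  proof (cases "fst v = 0")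
    case True
    then show ?thesis using that[of 1 0] by simp
  next
    case f: False
    define \<theta> where "\<theta> = snd v / fst v"
    show ?thesis
    proof (cases "\<theta> \<in> \<rat>")
      case True
      then obtain m n :: int where mn: "n > 0" "coprime m n" "\<theta> = of_int m / of_int n" by (rule Rats_cases')
      then have "m * fst v - n * snd v = 0" using f by (simp add: \<theta>_def field_simps)
      then show ?thesis using that[of m "-n"] mn by simp
    next
      case False
      \<comment> \<open>Kronecker's theorem: the line through \<open>(k, i)\<close> in direction
        \<open>v\<close> meets the vertical line through the centre at distance less than
        \<open>r\<close>, hence in the interior. Sliding back along \<open>v\<close> puts the
        lattice point \<open>(k, i)\<close> itself into the interior, a contradiction.\<close>
      obtain i k :: int where ik: "\<bar>k * \<theta> - i - (\<theta> * fst c - snd c)\<bar> < r"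
        using sequence_of_fractional_parts_is_dense[OF False r(1)] by metis
      define \<delta> where "\<delta> = i - snd c - \<theta> * (k - fst c)"
      have "\<bar>\<delta>\<bar> < r" using ik by (simp add: \<delta>_def algebra_simps abs_less_iff)
      then have "(0::real, \<delta>) \<in> ball 0 r" unfolding mem_ball_0 by (simp add: norm_Pair)
      moreover have "ball 0 r \<subseteq> interior C" using r by (intro interior_maximal) auto
      ultimately have "c + (0, \<delta>) \<in> interior K" unfolding K interior_translation by blast
      then have "c + (0, \<delta>) + ((k - fst c) / fst v) *\<^sub>R v \<in> interior K" by (rule shift)
      moreover have "c + (0, \<delta>) + ((k - fst c) / fst v) *\<^sub>R v = (of_int k, of_int i)"
        using f by (simp add: prod_eq_iff \<delta>_def \<theta>_def field_simps)
      ultimately show ?thesis using free by (auto simp: Z2_def)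
    qed
  qed
  define U where "U x = of_int a * fst x + of_int b * snd x" for x :: "real \<times> real"
  have notint: "U z \<noteq> of_int n" if z: "z \<in> interior K" for z and n :: int
  proof
    assume Uz: "U z = of_int n"
    \<comment> \<open>Bezout coefficients supply a lattice point \<open>p\<close> with
      \<open>U p = n\<close>. As \<open>U (p - z) = 0\<close>, the vector \<open>p - z\<close> is a
      multiple of \<open>v\<close>, and \<open>p\<close> is reached from \<open>z\<close> by an
      admissible shift.\<close>
    obtain x y :: int where "x * a + y * b = 1" using bezout_int[of a b] ab(1) by auto
    then have xy: "real_of_int x * a + real_of_int y * b = 1" by (metis of_int_1 of_int_add of_int_mult)
    define p where "p = (real_of_int (n * x), real_of_int (n * y))"
    have "U p = n * (real_of_int x * a + real_of_int y * b)" by (simp add: U_def p_def algebra_simps)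
    then have "U p = n" unfolding xy by simp
    moreover have "U (p - z) = U p - U z" by (simp add: U_def algebra_simps)
    ultimately have "U (p - z) = 0" using Uz by simp
    define d where "d = p - z"
    have eqs: "a * fst d + b * snd d = 0" "a * fst v + b * snd v = 0" using \<open>U (p - z) = 0\<close> ab by (auto simp: U_def d_def)
    have vv: "fst v * fst v + snd v * snd v = 1" using v(1) by (simp add: norm_prod_def power2_eq_square)
    have "a * (fst d * snd v - snd d * fst v) = 0" "b * (fst d * snd v - snd d * fst v) = 0"
      using eqs by algebra+
    moreover have "a \<noteq> 0 \<or> b \<noteq> 0" using ab by auto
    ultimately have det: "fst d * snd v - snd d * fst v = 0" by auto
    \<comment> \<open>\<open>v\<close> is a unit vector parallel to \<open>d\<close>, so
      \<open>d\<close> equals its orthogonal projection onto \<open>v\<close>.\<close>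
    have "fst d = (fst d * fst v + snd d * snd v) * fst v" "snd d = (fst d * fst v + snd d * snd v) * snd v"
      using det vv by algebra+
    then obtain \<tau> where "p - z = \<tau> *\<^sub>R v" unfolding d_def[symmetric]
      by (metis prod_eqI fst_scaleR snd_scaleR real_scaleR_def)
    then have "p = z + \<tau> *\<^sub>R v" by (simp add: diff_eq_eq add.commute)
    then have "p \<in> interior K" using shift[OF z] by simp
    moreover have "p \<in> Z2" by (auto simp: p_def Z2_def)
    ultimately show False using free by auto
  qed
  obtain z where z: "z \<in> interior K" using ne by blast
  define n where "n = \<lfloor>U z\<rfloor>"
  have nz: "n < U z" "U z < n + 1" using notint[OF z, of n] by (auto simp: n_def) linarith+
  have conn: "connected (U ` interior K)"
  proof (rule connected_continuous_image)
    show "continuous_on (interior K) U" unfolding U_def by (intro continuous_intros)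
    show "connected (interior K)" using cv by (simp add: convex_connected convex_interior)
  qed
  have btw: "n \<le> U x \<and> U x \<le> n + 1" if x: "x \<in> interior K" for x
  proof (rule ccontr)
    assume "\<not> ?thesis"
    then consider "U x \<le> n" | "n + 1 \<le> U x" by linarith
    then show False
    proof cases
      case 1
      then have "of_int n \<in> U ` interior K" using connectedD_interval[OF conn, of "U x" "U z" n] x z nz by auto
      then show False using notint by (metis imageE)
    next
      case 2
      then have "of_int (n + 1) \<in> U ` interior K" using connectedD_interval[OF conn, of "U z" "U x" "n + 1"] x z nz by auto
      then show False using notint by (metis imageE)
    qed
  qed
  define S :: "(real \<times> real) set" where "S = {x. of_int n \<le> of_int a * fst x + of_int b * snd x \<and> of_int a * fst x + of_int b * snd x \<le> of_int n + 1}"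
  have "closed S" unfolding S_def by (intro closed_Collect_conj closed_Collect_le continuous_intros)
  moreover have "interior K \<subseteq> S" using btw by (auto simp: S_def U_def)
  ultimately have "closure (interior K) \<subseteq> S" by (simp add: closure_minimal)
  then have "K \<subseteq> S" using convex_closure_interior[OF cv ne] closure_subset by blast
  moreover have "is_split S" unfolding is_split_def S_def using ab(1) by blast
  ultimately show "\<exists>S. is_split S \<and> K \<subseteq> S" by blast
qed

section \<open>Estimates for the width function and the lattice width\<close>

lemma lattice_width_le_split:
  assumes "is_split S" "K \<subseteq> S" "K \<noteq> {}"
  shows "lattice_width K \<le> 1"
proof -
  obtain a b n :: int where ab: "coprime a b"
    and S: "S = {x. of_int n \<le> of_int a * fst x + of_int b * snd x \<and> of_int a * fst x + of_int b * snd x \<le> of_int n + 1}"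
    using assms(1) unfolding is_split_def by blast
  have "width_fun K (a, b) \<le> ereal (of_int n + 1) - ereal (of_int n)"
    unfolding width_fun_def using assms(2)
    by (intro ereal_minus_mono SUP_least INF_greatest) (auto simp: S subset_iff)
  then have "width_fun K (a, b) \<le> 1" by (simp add: one_ereal_def)
  moreover have "(a, b) \<noteq> (0, 0)" using ab by auto
  ultimately show ?thesis unfolding lattice_width_def by (intro INF_lower2[of "(a, b)"]) auto
qed

lemma width_fun_ge:
  assumes "x \<in> C" "-x \<in> C" "h \<le> of_int (fst u) * fst x + of_int (snd u) * snd x"
  shows "ereal (2 * h) \<le> width_fun ((+) c ` C) u"
proof -
  let ?U = "\<lambda>x. of_int (fst u) * fst x + of_int (snd u) * snd x :: real"
  have "ereal (2 * h) \<le> ereal (?U (c + x)) - ereal (?U (c + (-x)))"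
    using assms(3) by (simp add: algebra_simps)
  also have "\<dots> \<le> width_fun ((+) c ` C) u" unfolding width_fun_def
    by (intro ereal_minus_mono SUP_upper INF_lower imageI assms)
  finally show ?thesis .
qed

lemma width_fun_le:
  assumes "\<And>x. x \<in> C \<Longrightarrow> -x \<in> C" "\<And>x. x \<in> C \<Longrightarrow> of_int (fst u) * fst x + of_int (snd u) * snd x \<le> h"
  shows "width_fun ((+) c ` C) u \<le> ereal (2 * h)"
proof -
  let ?U = "\<lambda>x. of_int (fst u) * fst x + of_int (snd u) * snd x :: real"
  have ge: "- h \<le> ?U x" if "x \<in> C" for x using assms(2)[OF assms(1)[OF that]] by simp
  have "width_fun ((+) c ` C) u \<le> ereal (?U c + h) - ereal (?U c - h)"
    unfolding width_fun_def
  proof (intro ereal_minus_mono SUP_least INF_greatest)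
    fix y assume "y \<in> (+) c ` C"
    then obtain x where x: "x \<in> C" "y = c + x" by blast
    show "ereal (?U y) \<le> ereal (?U c + h)" using assms(2)[OF x(1)] by (simp add: x algebra_simps)
    show "ereal (?U c - h) \<le> ereal (?U y)" using ge[OF x(1)] by (simp add: x algebra_simps)
  qed
  then show ?thesis by simp
qed

section \<open>Normal form\<close>

text \<open>The minimum over all lattice directions exists: a ball inside \<open>C\<close> makes the
  half-width \<open>H u\<close> at least a multiple of the entries of \<open>u\<close>, so only
  finitely many directions compete with (1,0). A minimiser is primitive, since dividing it by a
  common factor would divide the width as well.\<close>

lemma (in sym_body) minimal_width_direction:
  obtains a b :: int and p where "coprime a b" "p \<in> C" "0 < of_int a * fst p + of_int b * snd p"
    "\<And>x. x \<in> C \<Longrightarrow> of_int a * fst x + of_int b * snd x \<le> of_int a * fst p + of_int b * snd p"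
    "\<And>e f :: int. (e, f) \<noteq> (0, 0) \<Longrightarrow>
      \<exists>x\<in>C. of_int a * fst p + of_int b * snd p \<le> of_int e * fst x + of_int f * snd x"
proof -
  let ?U = "\<lambda>(u :: int \<times> int) x. of_int (fst u) * fst x + of_int (snd u) * snd x :: real"
  obtain r where r: "0 < r" "cball 0 r \<subseteq> C" using sym_convex_cball[OF convex_C interior_C sym_C] by blast
  have "C \<noteq> {}" using interior_C interior_subset by blast
  have "\<exists>p\<in>C. \<forall>x\<in>C. ?U u x \<le> ?U u p" for u
    by (rule continuous_attains_sup[OF compact_C \<open>C \<noteq> {}\<close>]) (intro continuous_intros)
  then obtain P where P: "\<And>u. P u \<in> C" "\<And>u x. x \<in> C \<Longrightarrow> ?U u x \<le> ?U u (P u)" by metis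
  define H where "H u = ?U u (P u)" for u
  have ax: "(r, 0) \<in> C" "(-r, 0) \<in> C" "(0, r) \<in> C" "(0, -r) \<in> C"
    using r(1) by (auto intro!: subsetD[OF r(2)] simp only: mem_cball_0 norm_Pair) auto
  have Hr: "\<bar>of_int (fst u)\<bar> * r \<le> H u" "\<bar>of_int (snd u)\<bar> * r \<le> H u" for u
    using P(2)[OF ax(1), of u] P(2)[OF ax(2), of u] P(2)[OF ax(3), of u] P(2)[OF ax(4), of u]
    by (auto simp: H_def abs_if)
  \<comment> \<open>The directions that are no worse than (1,0); a minimiser over this set is a
    minimiser over all nonzero directions.\<close>
  define F where "F = {u. u \<noteq> (0, 0) \<and> H u \<le> H (1, 0)}"
  define N where "N = \<lceil>H (1, 0) / r\<rceil>"
  have "F \<subseteq> {-N..N} \<times> {-N..N}"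
  proof
    fix u assume u: "u \<in> F"
    have bd: "\<bar>k\<bar> \<le> N" if "\<bar>of_int k\<bar> * r \<le> H (1, 0)" for k :: int
    proof -
      have "\<bar>real_of_int k\<bar> \<le> H (1, 0) / r" using that r by (simp add: field_simps)
      then show ?thesis unfolding N_def by linarith
    qed
    have "\<bar>fst u\<bar> \<le> N" "\<bar>snd u\<bar> \<le> N" using u Hr[of u] by (auto intro!: bd simp: F_def)
    then show "u \<in> {-N..N} \<times> {-N..N}" by (auto simp: mem_Times_iff abs_le_iff)
  qed
  then have "finite F" by (rule finite_subset) auto
  moreover have "(1, 0) \<in> F" by (simp add: F_def)
  ultimately obtain u where u: "u \<in> F" "\<And>u'. u' \<in> F \<Longrightarrow> H u \<le> H u'"
    using arg_min_if_finite(1)[of F H] arg_min_least[of F _ H] by (metis empty_iff)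
  have min: "H u \<le> H u'" if "u' \<noteq> (0, 0)" for u'
    using u(2)[of u'] u(1) that by (cases "H u' \<le> H (1, 0)") (auto simp: F_def)
  have u0: "u \<noteq> (0, 0)" using u by (simp add: F_def)
  then have "fst u \<noteq> 0 \<or> snd u \<noteq> 0" by (auto simp: prod_eq_iff)
  then have "0 < \<bar>real_of_int (fst u)\<bar> * r \<or> 0 < \<bar>real_of_int (snd u)\<bar> * r" using r(1) by auto
  then have Hpos: "0 < H u" using Hr[of u] by linarith
  have "coprime (fst u) (snd u)"
  proof (rule ccontr)
    assume nc: "\<not> coprime (fst u) (snd u)"
    define d where "d = gcd (fst u) (snd u)"
    have d0: "d > 0" using u0 by (auto simp: d_def prod_eq_iff)
    moreover have "d \<noteq> 1" using nc by (simp add: d_def coprime_iff_gcd_eq_1)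
    ultimately have d: "d \<ge> 2" by simp
    obtain e f where ef: "fst u = d * e" "snd u = d * f" unfolding d_def by (meson dvdE gcd_dvd1 gcd_dvd2)
    then have "(e, f) \<noteq> (0, 0)" using u0 by (auto simp: prod_eq_iff)
    then have "H u \<le> H (e, f)" by (rule min)
    moreover have "?U u (P (e, f)) = d * H (e, f)" by (simp add: ef H_def algebra_simps)
    then have "d * H (e, f) \<le> H u" using P(2)[OF P(1), of u "(e, f)"] by (simp add: H_def)
    moreover have "2 * H u \<le> d * H u" using d Hpos by (intro mult_right_mono) auto
    moreover have "d * H u \<le> d * H (e, f)" using \<open>H u \<le> H (e, f)\<close> d by (intro mult_left_mono) auto
    ultimately show False using Hpos by linarith
  qed
  then show thesis
  proof (rule that[OF _ P(1)[of u]])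
    show "0 < of_int (fst u) * fst (P u) + of_int (snd u) * snd (P u)" using Hpos by (simp add: H_def)
    show "of_int (fst u) * fst x + of_int (snd u) * snd x \<le> of_int (fst u) * fst (P u) + of_int (snd u) * snd (P u)"
      if "x \<in> C" for x using P(2)[OF that] .
    fix e f :: int assume "(e, f) \<noteq> (0, 0)"
    then have "H u \<le> H (e, f)" by (rule min)
    then show "\<exists>x\<in>C. of_int (fst u) * fst (P u) + of_int (snd u) * snd (P u) \<le> of_int e * fst x + of_int f * snd x"
      using P(1)[of "(e, f)"] by (auto simp: H_def)
  qed
qed

text \<open>The minimal direction \<open>(a, b)\<close> is completed by Bezout to an integer matrix
  of determinant 1 with first row \<open>(a, b)\<close>. Its map carries the functional
  \<open>(a, b)\<close> to the first coordinate and keeps area and lattice-freeness.\<close>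

lemma normal_form:
  fixes K :: "(real \<times> real) set"
  assumes cl: "closed K" and cv: "convex K" and ne: "interior K \<noteq> {}" and bd: "bounded K"
    and symK: "\<And>x. x \<in> K \<Longrightarrow> 2 *\<^sub>R c0 - x \<in> K" and free: "interior K \<inter> Z2 = {}"
  obtains f C c h where "unimodular f" "f ` K = (+) c ` C" "width_body C h"
    "lattice_width K = ereal (2 * h)" "emeasure lborel K = emeasure lborel C"
    "\<And>i j. (of_int i, of_int j) - c \<notin> interior C"
proof -
  define C0 where "C0 = (+) (-c0) ` K"
  have K: "K = (+) c0 ` C0" by (simp add: C0_def image_comp o_def)
  have K': "compact K" using cl bd by (simp add: compact_eq_bounded_closed)
  have "sym_body C0"
  proof
    show "compact C0" "convex C0" "interior C0 \<noteq> {}"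
      using compact_translation[OF K', of "-c0"] convex_translation[OF cv, of "-c0"] interior_translation[of "-c0" K] ne
      unfolding C0_def by simp_all
    fix x assume "x \<in> C0"
    then have "2 *\<^sub>R c0 - (c0 + x) \<in> K" using K by (intro symK) auto
    then show "-x \<in> C0" unfolding C0_def by (intro image_eqI[of _ _ "2 *\<^sub>R c0 - (c0 + x)"]) (auto simp: scaleR_2)
  qed
  then interpret C0: sym_body C0 .
  obtain a b :: int and p where ab: "coprime a b" and p: "p \<in> C0" "0 < of_int a * fst p + of_int b * snd p"
    and max: "\<And>x. x \<in> C0 \<Longrightarrow> of_int a * fst x + of_int b * snd x \<le> of_int a * fst p + of_int b * snd p"
    and min: "\<And>e f :: int. (e, f) \<noteq> (0, 0) \<Longrightarrow>
      \<exists>x\<in>C0. of_int a * fst p + of_int b * snd p \<le> of_int e * fst x + of_int f * snd x"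
    using C0.minimal_width_direction by metis
  define h where "h = of_int a * fst p + of_int b * snd p"
  obtain x y :: int where "x * a + y * b = 1" using bezout_int[of a b] ab(1) by auto
  then have xy: "a * x - b * (-y) = 1" by (simp add: algebra_simps)
  let ?M = "int_lin a b (-y) x"
  have det: "\<bar>a * x - b * (-y)\<bar> = 1" using xy by simp
  have uM: "unimodular ?M" using unimodular_int_lin[OF det, of 0] by (simp add: Z2_def)
  have bijM: "bij ?M" using uM unfolding unimodular_def by blast
  define C where "C = ?M ` C0"
  have "width_body C h"
  proof
    show "compact C" unfolding C_def using C0.compact_C compact_continuous_image continuous_on_lin by blast
    show "convex C" unfolding C_def by (rule convex_linear_image[OF linear_lin C0.convex_C])
    have "open (?M ` interior C0)"
      using bijM by (intro open_surjective_linear_image linear_lin) (auto simp: bij_is_surj)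
    moreover have "?M ` interior C0 \<subseteq> C" unfolding C_def using interior_subset by blast
    ultimately show "interior C \<noteq> {}" using C0.interior_C interior_maximal by blast
    show "-z \<in> C" if "z \<in> C" for z
      using that C0.sym_C unfolding C_def by (auto simp flip: linear_neg[OF linear_lin])
    show "0 < h" using p by (simp add: h_def)
    show "fst z \<le> h" if "z \<in> C" for z using that max by (auto simp: C_def h_def lin_def)
    have "fst (?M p) = h" by (simp add: lin_def h_def)
    then show "\<exists>p\<in>C. fst p = h" using p(1) unfolding C_def by blast
    fix e f :: int assume ef: "(e, f) \<noteq> (0, 0)"
    \<comment> \<open>A direction \<open>(e, f)\<close> on the image pulls back to the direction
      \<open>(e a - f y, e b + f x)\<close> on \<open>C0\<close>. These identities recover
      \<open>(e, f)\<close> from it, so it is nonzero too.\<close>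
    have "e = x * (e * a - f * y) + y * (e * b + f * x)" "f = a * (e * b + f * x) - b * (e * a - f * y)"
      using xy by algebra+
    then have "(e * a - f * y, e * b + f * x) \<noteq> (0, 0)" using ef by auto
    then obtain z where z: "z \<in> C0" "h \<le> of_int (e * a - f * y) * fst z + of_int (e * b + f * x) * snd z"
      using min h_def by blast
    then have "h \<le> of_int e * fst (?M z) + of_int f * snd (?M z)" by (simp add: lin_def algebra_simps)
    then show "\<exists>x\<in>C. h \<le> of_int e * fst x + of_int f * snd x" using z(1) unfolding C_def by blast
  qed
  then interpret width_body C h .
  have im: "?M ` K = (+) (?M c0) ` C"
    unfolding K C_def by (simp add: image_comp o_def linear_add[OF linear_lin])
  have lw: "lattice_width K = ereal (2 * h)"
  proof (rule antisym)
    have "width_fun K (a, b) \<le> ereal (2 * h)" unfolding K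
      by (rule width_fun_le[OF C0.sym_C]) (use max h_def in auto)
    moreover have "(a, b) \<noteq> (0, 0)" using ab by auto
    ultimately show "lattice_width K \<le> ereal (2 * h)"
      unfolding lattice_width_def by (intro INF_lower2[of "(a, b)"]) auto
    show "ereal (2 * h) \<le> lattice_width K" unfolding lattice_width_def
    proof (rule INF_greatest)
      fix u :: "int \<times> int" assume "u \<in> UNIV - {(0, 0)}"
      then obtain z where "z \<in> C0" "h \<le> of_int (fst u) * fst z + of_int (snd u) * snd z"
        using min[of "fst u" "snd u"] h_def by (auto simp: prod_eq_iff)
      then show "ereal (2 * h) \<le> width_fun K u" unfolding K using C0.sym_C by (intro width_fun_ge) auto
    qed
  qed
  have "emeasure lborel (?M ` K) = emeasure lborel K" by (rule area_unimodular_image[OF uM K'])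
  then have ar: "emeasure lborel K = emeasure lborel C" unfolding im using emeasure_lborel_translate[OF borel_C] by simp
  have fr: "(of_int i, of_int j) - ?M c0 \<notin> interior C" for i j
  proof
    assume "(of_int i, of_int j) - ?M c0 \<in> interior C"
    then have "(of_int i, of_int j) \<in> interior (?M ` K)"
      unfolding im interior_translation by (intro image_eqI[of _ _ "(of_int i, of_int j) - ?M c0"]) auto
    moreover have "(of_int i, of_int j) \<in> Z2" by (simp add: Z2_def)
    ultimately show False using lattice_free_image[OF uM free] by blast
  qed
  show thesis by (rule that[OF uM im \<open>width_body C h\<close> lw ar fr])
qed

section \<open>Standard forms of crosses and the converse implications of the equality cases\<close>

lemma unimodular_translate: "t \<in> Z2 \<Longrightarrow> unimodular (\<lambda>x. x + t)"
  using unimodular_int_lin[of 1 1 0 0 t] by (simp add: lin_def)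

lemma scaled_cross:
  fixes t :: "real \<times> real"
  shows "(\<lambda>x. h *\<^sub>R x + t) ` (convex hull {(1, \<alpha>), (-1, -\<alpha>), (0, 1), (0, -1)})
    = (+) t ` (convex hull {(h, \<alpha> * h), -(h, \<alpha> * h), (0, h), -(0, h)})"
proof -
  have "(\<lambda>x. h *\<^sub>R x) ` (convex hull {(1, \<alpha>), (-1, -\<alpha>), (0, 1), (0, -1)})
      = convex hull {(h, \<alpha> * h), -(h, \<alpha> * h), (0, h), -(0, h)}"
    unfolding convex_hull_scaling[symmetric] by (simp add: mult.commute)
  then have "(+) t ` (\<lambda>x. h *\<^sub>R x) ` (convex hull {(1, \<alpha>), (-1, -\<alpha>), (0, 1), (0, -1)})
      = (+) t ` (convex hull {(h, \<alpha> * h), -(h, \<alpha> * h), (0, h), -(0, h)})" by (rule arg_cong)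
  then show ?thesis by (simp only: image_image add.commute)
qed

text \<open>Serves the converse directions of (III) and (IV): the area of \<open>K\<close> is that
  of the cross, because the inverse of \<open>f\<close> is unimodular too.\<close>

lemma area_preimage_cross:
  assumes f: "unimodular f" and K: "f ` K = (+) t ` (convex hull {p, -p, q, -q})" and det: "det2 p q \<noteq> 0"
  shows "emeasure lborel K = ennreal (2 * \<bar>det2 p q\<bar>)"
proof -
  have "bij f" using f unfolding unimodular_def by blast
  then have "K = inv f ` (f ` K)" by (simp add: bij_is_inj image_inv_f_f)
  then have "K = inv f ` ((+) t ` (convex hull {p, -p, q, -q}))" unfolding K .
  moreover have cpt: "compact (convex hull {p, -p, q, -q})" by (simp add: finite_imp_compact_convex_hull)
  ultimately have "emeasure lborel K = emeasure lborel ((+) t ` (convex hull {p, -p, q, -q}))"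
    using area_unimodular_image[OF unimodular_inv[OF f]] compact_translation by metis
  also have "\<dots> = emeasure lborel (convex hull {p, -p, q, -q})"
    by (rule emeasure_lborel_translate[OF borel_closed[OF compact_imp_closed[OF cpt]]])
  finally show ?thesis using area_cross[OF det] by simp
qed

text \<open>Serves the converse direction of (I). A nonzero lattice direction, pulled back to the
  cross, is a nonzero integer vector \<open>(m, n)\<close>; some entry has absolute value at least
  1, so the two vertices on that axis are at least 2 apart.\<close>

lemma lattice_width_preimage_unit_cross:
  assumes f: "unimodular f" and K: "f ` K = (+) t ` (convex hull {(1, 0), -(1, 0), (0, 1), -(0, 1)})"
  shows "2 \<le> lattice_width K"
proof -
  let ?Q = "convex hull {(1, 0), -(1, 0), (0, 1), -(0, 1)} :: (real \<times> real) set"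
  obtain a b c d s where g: "\<bar>a * d - b * c\<bar> = (1::int)" "inv f = (\<lambda>x. int_lin a b c d x + s)"
    using unimodular_inv[OF f] by (rule unimodularE)
  have "bij f" using f unfolding unimodular_def by blast
  then have "K = inv f ` (f ` K)" by (simp add: bij_is_inj image_inv_f_f)
  then have K': "K = (+) (int_lin a b c d t + s) ` (int_lin a b c d ` ?Q)"
    unfolding K g(2) by (simp add: image_comp o_def linear_add[OF linear_lin] algebra_simps)
  have Qm: "(1, 0) \<in> ?Q" "(-1, 0) \<in> ?Q" "(0, 1) \<in> ?Q" "(0, -1) \<in> ?Q" by (auto intro: hull_inc)
  have M: "int_lin a b c d (1, 0) = (of_int a, of_int c)" "int_lin a b c d (-1, 0) = - (of_int a, of_int c)"
    "int_lin a b c d (0, 1) = (of_int b, of_int d)" "int_lin a b c d (0, -1) = - (of_int b, of_int d)"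
    by (auto simp: lin_def)
  have mem: "(of_int a, of_int c) \<in> int_lin a b c d ` ?Q" "- (of_int a, of_int c) \<in> int_lin a b c d ` ?Q"
    "(of_int b, of_int d) \<in> int_lin a b c d ` ?Q" "- (of_int b, of_int d) \<in> int_lin a b c d ` ?Q"
    using Qm M by (metis imageI)+
  show ?thesis unfolding lattice_width_def
  proof (rule INF_greatest)
    fix u :: "int \<times> int" assume u: "u \<in> UNIV - {(0, 0)}"
    define m where "m = fst u * a + snd u * c"
    define n where "n = fst u * b + snd u * d"
    \<comment> \<open>Cramer's rule: \<open>m = n = 0\<close> would force \<open>u = 0\<close>, as
      the determinant is 1 or -1.\<close>
    have "fst u * (a * d - b * c) = m * d - n * c" "snd u * (a * d - b * c) = n * a - m * b"
      by (auto simp: m_def n_def algebra_simps)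
    then have "m \<noteq> 0 \<or> n \<noteq> 0" using u g(1) by (auto simp: prod_eq_iff)
    then consider "m \<ge> 1" | "m \<le> -1" | "n \<ge> 1" | "n \<le> -1" by linarith
    then have "ereal (2 * 1) \<le> width_fun K u" unfolding K'
    proof cases
      case 1
      then have "1 \<le> real_of_int m" by simp
      then show "ereal (2 * 1) \<le> width_fun ((+) (int_lin a b c d t + s) ` (int_lin a b c d ` ?Q)) u"
        by (intro width_fun_ge[OF mem(1,2)]) (simp add: m_def)
    next
      case 2
      then have "1 \<le> - real_of_int m" by simp
      then show "ereal (2 * 1) \<le> width_fun ((+) (int_lin a b c d t + s) ` (int_lin a b c d ` ?Q)) u"
        using mem(1,2) by (intro width_fun_ge[of "- (of_int a, of_int c)"]) (simp_all add: m_def)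
    next
      case 3
      then have "1 \<le> real_of_int n" by simp
      then show "ereal (2 * 1) \<le> width_fun ((+) (int_lin a b c d t + s) ` (int_lin a b c d ` ?Q)) u"
        by (intro width_fun_ge[OF mem(3,4)]) (simp add: n_def)
    next
      case 4
      then have "1 \<le> - real_of_int n" by simp
      then show "ereal (2 * 1) \<le> width_fun ((+) (int_lin a b c d t + s) ` (int_lin a b c d ` ?Q)) u"
        using mem(3,4) by (intro width_fun_ge[of "- (of_int b, of_int d)"]) (simp_all add: n_def)
    qed
    then show "2 \<le> width_fun K u" by simp
  qed
qed

text \<open>Collects every assertion about bounded \<open>K\<close> by applying the two area bounds
  to the normal form with \<open>h = w / 2\<close>; the equality shapes of \<open>C\<close> are
  carried back to \<open>K\<close> through the composed unimodular maps.\<close>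

lemma bounded_case:
  fixes K :: "(real \<times> real) set"
  assumes cl: "closed K" and cv: "convex K" and ne: "interior K \<noteq> {}" and bd: "bounded K"
    and symK: "\<And>x. x \<in> K \<Longrightarrow> 2 *\<^sub>R c0 - x \<in> K" and free: "interior K \<inter> Z2 = {}"
  obtains w where "lattice_width K = ereal w" "0 < w" "w \<le> 2"
    "1 < w \<Longrightarrow> emeasure lborel K \<le> ennreal (w\<^sup>2 / (2 * (w - 1)))"
    "ennreal (w\<^sup>2 / 2) \<le> emeasure lborel K"
    "1 < w \<Longrightarrow> emeasure lborel K = ennreal (w\<^sup>2 / (2 * (w - 1))) \<Longrightarrow> \<exists>f. unimodular f \<and> f ` K =
      (+) (1/2, 1/2) ` (convex hull {(w/2, 0), -(w/2, 0), (0, w / (2 * (w - 1))), -(0, w / (2 * (w - 1)))})"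
    "w = 2 \<Longrightarrow> \<exists>f. unimodular f \<and> f ` K = (+) (1/2, 1/2) ` (convex hull {(1, 0), -(1, 0), (0, 1), -(0, 1)})"
    "emeasure lborel K = ennreal (w\<^sup>2 / 2) \<Longrightarrow> \<exists>f \<alpha> t. unimodular f \<and> 0 \<le> \<alpha> \<and> \<alpha> < 1 \<and> w \<le> max (1 + \<alpha>) (2 - \<alpha>) \<and>
      f ` K = (+) t ` (convex hull {(w/2, \<alpha> * (w/2)), -(w/2, \<alpha> * (w/2)), (0, w/2), -(0, w/2)})"
proof -
  obtain f C c h where f: "unimodular f" "f ` K = (+) c ` C" and wb: "width_body C h"
    and lw: "lattice_width K = ereal (2 * h)" and ar: "emeasure lborel K = emeasure lborel C"
    and frC: "\<And>i j. (of_int i, of_int j) - c \<notin> interior C"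
    using normal_form[OF cl cv ne bd symK free] by metis
  interpret width_body C h by (rule wb)
  define w where "w = 2 * h"
  have w2: "w\<^sup>2 / 2 = 2 * h\<^sup>2" "w / 2 = h" by (auto simp: w_def power2_eq_square)
  have slab: "lattice_free_slab C h c" if "1 / 2 < h"
    by unfold_locales (use that frC in auto)
  have h1: "h \<le> 1"
  proof (rule ccontr)
    assume "\<not> h \<le> 1"
    then interpret lattice_free_slab C h c by (intro slab) auto
    have "ennreal (2 * h\<^sup>2) \<le> ennreal (2 * h)" using area_ge area_le_2h \<open>\<not> h \<le> 1\<close> by (meson linear order_trans)
    then have "h * h \<le> h * 1" using h_pos by (simp add: power2_eq_square ennreal_le_iff)
    then show False using \<open>\<not> h \<le> 1\<close> h_pos by simp
  qed
  \<comment> \<open>A centre congruent to (1/2, 1/2) modulo the lattice is moved there by a lattice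
    translation.\<close>
  have move: "\<exists>f. unimodular f \<and> f ` K = (+) (1/2, 1/2) ` Q"
    if g: "unimodular g" "g ` K = (+) t ` Q" "t - (1/2, 1/2) \<in> Z2" for g t Q
  proof -
    have "0 - (t - (1/2, 1/2)) \<in> Z2" by (rule diff_Z2[OF _ g(3)]) (simp add: Z2_def)
    then have "- (t - (1/2, 1/2)) \<in> Z2" by (simp only: diff_0)
    then have u: "unimodular ((\<lambda>x. x + - (t - (1/2, 1/2))) \<circ> g)"
      by (intro unimodular_compose unimodular_translate g(1))
    have "((\<lambda>x. x + - (t - (1/2, 1/2))) \<circ> g) ` K = (\<lambda>x. x + - (t - (1/2, 1/2))) ` ((+) t ` Q)"
      by (simp only: image_comp[symmetric] g(2))
    also have "\<dots> = (+) (1/2, 1/2) ` Q" by (simp add: image_comp o_def algebra_simps)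
    finally show ?thesis using u by blast
  qed
  have linK: "unimodular (int_lin a b c' d \<circ> f)" "(int_lin a b c' d \<circ> f) ` K = (+) (int_lin a b c' d c) ` (int_lin a b c' d ` C)"
    if "\<bar>a * d - b * c'\<bar> = 1" for a b c' d
  proof -
    have "unimodular (int_lin a b c' d)" using unimodular_int_lin[OF that, of 0] by (simp add: Z2_def)
    then show "unimodular (int_lin a b c' d \<circ> f)" using f(1) unimodular_compose by blast
    have "(int_lin a b c' d \<circ> f) ` K = int_lin a b c' d ` ((+) c ` C)" by (simp only: image_comp[symmetric] f(2))
    then show "(int_lin a b c' d \<circ> f) ` K = (+) (int_lin a b c' d c) ` (int_lin a b c' d ` C)"
      by (simp add: image_comp o_def linear_add[OF linear_lin])
  qed
  \<comment> \<open>Besides the shape, the last clause records that no lattice point is in the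
    interior of the cross. Through \<open>lattice_covering\<close> it limits
    \<open>\<alpha>\<close>, and for \<open>w = 2\<close> it determines the centre.\<close>
  have shape: "\<exists>f \<alpha> t. unimodular f \<and> 0 \<le> \<alpha> \<and> \<alpha> < 1 \<and> 2 * h \<le> max (1 + \<alpha>) (2 - \<alpha>) \<and>
      f ` K = (+) t ` (convex hull {(h, \<alpha> * h), -(h, \<alpha> * h), (0, h), -(0, h)}) \<and>
      (\<forall>i j. h \<le> \<bar>of_int i - fst t\<bar> + \<bar>(of_int j - snd t) - \<alpha> * (of_int i - fst t)\<bar>)"
    if eq: "emeasure lborel C = ennreal (2 * h\<^sup>2)"
  proof -
    obtain a d b c' \<alpha> where M: "\<bar>a * d - b * c'\<bar> = 1" and \<alpha>: "0 \<le> \<alpha>" "\<alpha> < 1"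
      and im: "int_lin a b c' d ` C = convex hull {(h, \<alpha> * h), -(h, \<alpha> * h), (0, h), -(0, h)}"
      using area_eq_imp_shape[OF eq] by metis
    let ?g = "int_lin a b c' d \<circ> f" and ?t = "int_lin a b c' d c"
    let ?Q = "convex hull {(h, \<alpha> * h), -(h, \<alpha> * h), (0, h), -(0, h)}"
    have gK: "?g ` K = (+) ?t ` ?Q" using linK(2)[OF M] im by simp
    have far: "h \<le> \<bar>of_int i - fst ?t\<bar> + \<bar>(of_int j - snd ?t) - \<alpha> * (of_int i - fst ?t)\<bar>" for i j
    proof (rule ccontr)
      let ?x = "(of_int i, of_int j) - ?t"
      assume "\<not> ?thesis"
      then have "\<bar>fst ?x\<bar> / h + \<bar>snd ?x - \<alpha> * fst ?x\<bar> / h < 1" using h_pos by (simp flip: add_divide_distrib)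
      then have "?x \<in> interior ?Q" using h_pos by (intro mem_interior_cross) auto
      then have "(of_int i, of_int j) \<in> interior (?g ` K)"
        unfolding gK interior_translation by (intro image_eqI[of _ _ ?x]) auto
      moreover have "(of_int i, of_int j) \<in> Z2" by (simp add: Z2_def)
      ultimately show False using lattice_free_image[OF linK(1)[OF M] free] by blast
    qed
    have "2 * h \<le> max (1 + \<alpha>) (2 - \<alpha>)"
    proof (rule ccontr)
      assume "\<not> ?thesis"
      then have "1 + \<alpha> < 2 * h" "2 - \<alpha> < 2 * h" by auto
      then show False using lattice_covering[OF \<alpha>, of h "fst ?t" "snd ?t"] far by (meson not_le)
    qed
    then show ?thesis using linK(1)[OF M] \<alpha> gK far by blast
  qed
  have two: "\<exists>f. unimodular f \<and> f ` K = (+) (1/2, 1/2) ` (convex hull {(1, 0), -(1, 0), (0, 1), -(0, 1)})"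
    if "h = 1"
  proof -
    interpret lattice_free_slab C h c by (intro slab) (use that in simp)
    have "emeasure lborel C = ennreal (2 * h\<^sup>2)" using area_ge area_le_2h that by (intro antisym) auto
    then obtain g \<alpha> t where g: "unimodular g" "0 \<le> \<alpha>" "\<alpha> < 1" "2 * h \<le> max (1 + \<alpha>) (2 - \<alpha>)"
      "g ` K = (+) t ` (convex hull {(h, \<alpha> * h), -(h, \<alpha> * h), (0, h), -(0, h)})"
      "\<And>i j. h \<le> \<bar>of_int i - fst t\<bar> + \<bar>(of_int j - snd t) - \<alpha> * (of_int i - fst t)\<bar>"
      using shape by metis
    \<comment> \<open>At \<open>h = 1\<close> the two area bounds coincide, so the equality shape
      applies; \<open>2 \<le> max (1 + \<alpha>) (2 - \<alpha>)\<close> with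
      \<open>\<alpha> < 1\<close> leaves only 0.\<close>
    have \<alpha>: "\<alpha> = 0" using g(2-4) that by (auto simp: max_def split: if_splits)
    have "(fst t, snd t) - (1/2, 1/2) \<in> Z2"
      by (rule half_int_of_lattice_free) (use g(6) \<alpha> that in simp)
    moreover have "g ` K = (+) t ` (convex hull {(1, 0), -(1, 0), (0, 1), -(0, 1)})" using g(5) by (simp add: \<alpha> that)
    ultimately show ?thesis using move[OF g(1)] by simp
  qed
  have bw: "h\<^sup>2 / (h - 1 / 2) = w\<^sup>2 / (2 * (w - 1))" if "1 / 2 < h"
    using that by (simp add: w_def field_simps power2_eq_square)
  have gw: "h / (2 * h - 1) = w / (2 * (w - 1))" if "1 / 2 < h"
    using that by (simp add: w_def field_simps)
  have upper: "emeasure lborel K \<le> ennreal (w\<^sup>2 / (2 * (w - 1)))" if "1 < w"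
  proof -
    have h: "1 / 2 < h" using that by (simp add: w_def)
    interpret lattice_free_slab C h c by (rule slab[OF h])
    show ?thesis using area_le_bound[OF h1] unfolding bound_def bw[OF h] ar .
  qed
  have upper_eq: "\<exists>f. unimodular f \<and> f ` K =
      (+) (1/2, 1/2) ` (convex hull {(w/2, 0), -(w/2, 0), (0, w / (2 * (w - 1))), -(0, w / (2 * (w - 1)))})"
    if "1 < w" and eq: "emeasure lborel K = ennreal (w\<^sup>2 / (2 * (w - 1)))"
  proof (cases "h = 1")
    \<comment> \<open>At \<open>w = 2\<close> the extremal cross of (III) is the unit cross, because
      \<open>w / (2 * (w - 1)) = 1\<close>; \<open>equality_shape\<close> covers
      \<open>h < 1\<close>.\<close>
    case True
    then show ?thesis using two by (simp add: w_def)
  next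
    case False
    have h: "1 / 2 < h" using that by (simp add: w_def)
    interpret lattice_free_slab C h c by (rule slab[OF h])
    have "emeasure lborel C = ennreal bound" using eq unfolding bound_def bw[OF h] ar .
    then obtain k :: int where
      k: "int_lin 1 0 (-k) 1 ` C = convex hull {(h, 0), -(h, 0), (0, h / (2*h - 1)), -(0, h / (2*h - 1))}"
        "int_lin 1 0 (-k) 1 c - (1/2, 1/2) \<in> Z2"
      using equality_shape h1 False by (metis less_eq_real_def)
    have "\<bar>1 * 1 - 0 * (-k)\<bar> = 1" by simp
    from move[OF linK[OF this] k(2)] show ?thesis unfolding k(1) gw[OF h] w2 .
  qed
  have lower_eq: "\<exists>f \<alpha> t. unimodular f \<and> 0 \<le> \<alpha> \<and> \<alpha> < 1 \<and> w \<le> max (1 + \<alpha>) (2 - \<alpha>) \<and>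
      f ` K = (+) t ` (convex hull {(w/2, \<alpha> * (w/2)), -(w/2, \<alpha> * (w/2)), (0, w/2), -(0, w/2)})"
    if "emeasure lborel K = ennreal (w\<^sup>2 / 2)"
    using shape that unfolding ar w2 w_def[symmetric] by blast
  show thesis
  proof (rule that[OF _ _ _ upper _ upper_eq _ lower_eq])
    show "lattice_width K = ereal w" "0 < w" "w \<le> 2" using lw h_pos h1 by (auto simp: w_def)
    show "ennreal (w\<^sup>2 / 2) \<le> emeasure lborel K" unfolding w2 ar by (rule area_ge)
    show "w = 2 \<Longrightarrow> \<exists>f. unimodular f \<and> f ` K = (+) (1/2, 1/2) ` (convex hull {(1, 0), -(1, 0), (0, 1), -(0, 1)})"
      using two by (simp add: w_def)
  qed
qed

text \<open>A nonzero integer direction has an entry of absolute value at least 1, so its width on a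
  ball of radius \<open>r\<close> is at least \<open>2 * r\<close>. The bound is uniform in the
  direction and also applies to unbounded \<open>K\<close>.\<close>

lemma lattice_width_pos:
  assumes "interior K \<noteq> {}"
  shows "0 < lattice_width K"
proof -
  obtain z r where zr: "0 < r" "cball z r \<subseteq> K"
    using assms by (meson ex_in_conv mem_interior_cball)
  have "ereal (2 * r) \<le> width_fun K u" if "u \<noteq> (0, 0)" for u
  proof -
    have "\<exists>x\<in>cball 0 r. r \<le> of_int (fst u) * fst x + of_int (snd u) * snd x"
    proof (cases "fst u = 0")
      case True
      then have "snd u \<noteq> 0" using that by (auto simp: prod_eq_iff)
      then have "1 \<le> real_of_int \<bar>snd u\<bar>" by linarith
      then have "1 * r \<le> real_of_int \<bar>snd u\<bar> * r" using zr by (intro mult_right_mono) auto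
      then show ?thesis using zr True
        by (intro bexI[of _ "(0, of_int (sgn (snd u)) * r)"]) (auto simp: norm_Pair abs_mult sgn_if)
    next
      case False
      then have "1 \<le> real_of_int \<bar>fst u\<bar>" by linarith
      then have "1 * r \<le> real_of_int \<bar>fst u\<bar> * r" using zr by (intro mult_right_mono) auto
      then show ?thesis using zr
        by (intro bexI[of _ "(of_int (sgn (fst u)) * r, 0)"]) (auto simp: norm_Pair abs_mult sgn_if)
    qed
    then obtain x where x: "x \<in> cball 0 r" "r \<le> of_int (fst u) * fst x + of_int (snd u) * snd x" by blast
    then have "ereal (2 * r) \<le> width_fun ((+) z ` cball 0 r) u" by (intro width_fun_ge) auto
    also have "(+) z ` cball 0 r = cball z r" by (simp add: cball_translation)
    also have "width_fun (cball z r) u \<le> width_fun K u" unfolding width_fun_def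
      using zr(2) by (intro ereal_minus_mono SUP_subset_mono INF_superset_mono) auto
    finally show ?thesis .
  qed
  then have "ereal (2 * r) \<le> lattice_width K" unfolding lattice_width_def by (intro INF_greatest) auto
  then show ?thesis using zr(1) by (metis ereal_less(2) less_le_trans mult_pos_pos zero_less_numeral)
qed

theorem theorem4:
  fixes K :: "(real \<times> real) set"
  assumes "closed K" and "convex K" and "interior K \<noteq> {}"
    and "centrally_symmetric K" and "interior K \<inter> Z2 = {}"
  defines "w \<equiv> real_of_ereal (lattice_width K)"
  shows "0 < lattice_width K \<and> lattice_width K \<le> 2
    \<and> (1 < w \<and> w \<le> 2 \<longrightarrow> area K \<le> ennreal (w\<^sup>2 / (2 * (w - 1))))
    \<and> area K \<ge> ennreal (w\<^sup>2 / 2)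
    \<and> (w = 2 \<longleftrightarrow> (\<exists>f. unimodular f \<and>
          f ` K = (\<lambda>x. x + (1/2, 1/2)) ` (convex hull {(1,0), (-1,0), (0,1), (0,-1)})))
    \<and> (0 < w \<and> w \<le> 1 \<longrightarrow>
          (area K = \<infinity> \<longleftrightarrow> \<not> bounded K \<and> (\<exists>S. is_split S \<and> K \<subseteq> S)))
    \<and> (1 < w \<and> w \<le> 2 \<longrightarrow>
          (area K = ennreal (w\<^sup>2 / (2 * (w - 1))) \<longleftrightarrow>
            (\<exists>f. unimodular f \<and>
              f ` K = (\<lambda>x. x + (1/2, 1/2)) `
                (convex hull {(w/2, 0), (-(w/2), 0), (0, w / (2 * (w - 1))), (0, -(w / (2 * (w - 1))))}))))
    \<and> (area K = ennreal (w\<^sup>2 / 2) \<longleftrightarrow>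
          (\<exists>f \<alpha> t. unimodular f \<and> 0 \<le> \<alpha> \<and> \<alpha> < 1 \<and> max (1 + \<alpha>) (2 - \<alpha>) \<ge> w \<and>
              f ` K = (\<lambda>x. (w/2) *\<^sub>R x + t) ` (convex hull {(1,\<alpha>), (-1,-\<alpha>), (0,1), (0,-1)})))"
proof -
  obtain c where c: "K = (\<lambda>x. 2 *\<^sub>R c - x) ` K" using assms(4) unfolding centrally_symmetric_def by blast
  then have sym: "2 *\<^sub>R c - x \<in> K" if "x \<in> K" for x using that by blast
  let ?I = "convex hull {(1, 0), -(1, 0), (0, 1), -(0, 1)} :: (real \<times> real) set"
  let ?III = "convex hull {(w/2, 0), -(w/2, 0), (0, w / (2 * (w - 1))), -(0, w / (2 * (w - 1)))}"
  let ?IV = "\<lambda>\<alpha>. convex hull {(w/2, \<alpha> * (w/2)), -(w/2, \<alpha> * (w/2)), (0, w/2), -(0, w/2)}"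
  have eI: "(\<lambda>x. x + (1/2, 1/2)) ` (convex hull {(1,0), (-1,0), (0,1), (0,-1)}) = (+) (1/2, 1/2) ` ?I"
    by (simp add: add.commute)
  have eIII: "(\<lambda>x. x + (1/2, 1/2)) `
      (convex hull {(w/2, 0), (-(w/2), 0), (0, w / (2 * (w - 1))), (0, -(w / (2 * (w - 1))))}) = (+) (1/2, 1/2) ` ?III"
    by (simp add: add.commute)
  note IV = scaled_cross[of "w/2"]
  have pos: "0 < lattice_width K" by (rule lattice_width_pos[OF assms(3)])
  have "K \<noteq> {}" using assms(3) interior_subset by blast
  \<comment> \<open>The forward implications and the infinite-area equivalence, proved for bounded
    and unbounded \<open>K\<close> separately.\<close>
  have main: "lattice_width K \<le> 2 \<and>
    (1 < w \<longrightarrow> emeasure lborel K \<le> ennreal (w\<^sup>2 / (2 * (w - 1)))) \<and>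
    ennreal (w\<^sup>2 / 2) \<le> emeasure lborel K \<and>
    (w = 2 \<longrightarrow> (\<exists>f. unimodular f \<and> f ` K = (+) (1/2, 1/2) ` ?I)) \<and>
    (emeasure lborel K = \<infinity> \<longleftrightarrow> \<not> bounded K \<and> (\<exists>S. is_split S \<and> K \<subseteq> S)) \<and>
    (1 < w \<and> emeasure lborel K = ennreal (w\<^sup>2 / (2 * (w - 1))) \<longrightarrow>
      (\<exists>f. unimodular f \<and> f ` K = (+) (1/2, 1/2) ` ?III)) \<and>
    (emeasure lborel K = ennreal (w\<^sup>2 / 2) \<longrightarrow>
      (\<exists>f \<alpha> t. unimodular f \<and> 0 \<le> \<alpha> \<and> \<alpha> < 1 \<and> w \<le> max (1 + \<alpha>) (2 - \<alpha>) \<and> f ` K = (+) t ` ?IV \<alpha>))"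
  proof (cases "bounded K")
    case True
    obtain w' where "lattice_width K = ereal w'" and w': "0 < w'" "w' \<le> 2"
      "1 < w' \<Longrightarrow> emeasure lborel K \<le> ennreal (w'\<^sup>2 / (2 * (w' - 1)))"
      "ennreal (w'\<^sup>2 / 2) \<le> emeasure lborel K"
      "1 < w' \<Longrightarrow> emeasure lborel K = ennreal (w'\<^sup>2 / (2 * (w' - 1))) \<Longrightarrow> \<exists>f. unimodular f \<and> f ` K =
        (+) (1/2, 1/2) ` (convex hull {(w'/2, 0), -(w'/2, 0), (0, w' / (2 * (w' - 1))), -(0, w' / (2 * (w' - 1)))})"
      "w' = 2 \<Longrightarrow> \<exists>f. unimodular f \<and> f ` K = (+) (1/2, 1/2) ` ?I"
      "emeasure lborel K = ennreal (w'\<^sup>2 / 2) \<Longrightarrow> \<exists>f \<alpha> t. unimodular f \<and> 0 \<le> \<alpha> \<and> \<alpha> < 1 \<and> w' \<le> max (1 + \<alpha>) (2 - \<alpha>) \<and>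
        f ` K = (+) t ` (convex hull {(w'/2, \<alpha> * (w'/2)), -(w'/2, \<alpha> * (w'/2)), (0, w'/2), -(0, w'/2)})"
      using bounded_case[OF assms(1-3) True sym assms(5)] by blast
    then have "w' = w" and lw: "lattice_width K = ereal w" by (auto simp: w_def)
    note w = w'[unfolded \<open>w' = w\<close>]
    have "emeasure lborel K \<noteq> \<infinity>" using emeasure_bounded_finite[OF True] by simp
    moreover have "lattice_width K \<le> 2" using lw w(2) by simp
    ultimately show ?thesis using True w(3-7) by blast
  next
    case False
    have inf: "emeasure lborel K = \<infinity>" and split: "\<exists>S. is_split S \<and> K \<subseteq> S"
      using unbounded_subset_split[OF assms(1-3) sym assms(5) False] by auto
    \<comment> \<open>An unbounded \<open>K\<close> lies in a split, so \<open>w \<le> 1\<close> and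
      the clauses for larger \<open>w\<close> hold vacuously; the infinite area settles the
      others.\<close>
    have lw: "lattice_width K \<le> 1" using split lattice_width_le_split \<open>K \<noteq> {}\<close> by blast
    then obtain x where x: "lattice_width K = ereal x" using pos by (cases "lattice_width K") auto
    then have "w \<le> 1" using lw by (simp add: w_def)
    moreover have "lattice_width K \<le> 2" by (rule order_trans[OF lw]) simp
    ultimately show ?thesis using inf split False by simp
  qed
  \<comment> \<open>The lattice width lies between 0 and 2, so it is finite and
    \<open>real_of_ereal\<close> returns it faithfully instead of the default 0 for infinite
    values.\<close>
  obtain x where "lattice_width K = ereal x" using pos main by (cases "lattice_width K") auto
  then have lw: "lattice_width K = ereal w" by (simp add: w_def)
  have w0: "0 < w" "w \<le> 2" using pos main lw by auto
  have revI: "w = 2" if "unimodular f" "f ` K = (+) (1/2, 1/2) ` ?I" for f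
    using lattice_width_preimage_unit_cross[OF that] w0 lw by simp
  have revIII: "emeasure lborel K = ennreal (w\<^sup>2 / (2 * (w - 1)))"
    if "1 < w" "unimodular f" "f ` K = (+) (1/2, 1/2) ` ?III" for f
  proof -
    define D where "D = w\<^sup>2 / (2 * (w - 1))"
    have det: "det2 (w/2, 0) (0, w / (2 * (w - 1))) = D / 2"
      by (simp add: det2_def D_def power2_eq_square)
    have "0 < D" using that(1) w0 by (simp add: D_def)
    then have "emeasure lborel K = ennreal D" using area_preimage_cross[OF that(2,3)] unfolding det by simp
    then show ?thesis by (simp only: D_def)
  qed
  have revIV: "emeasure lborel K = ennreal (w\<^sup>2 / 2)"
    if "unimodular f" "f ` K = (+) t ` ?IV \<alpha>" for f t \<alpha>
  proof -
    have det: "det2 (w/2, \<alpha> * (w/2)) (0, w/2) = w\<^sup>2 / 4" by (simp add: det2_def power2_eq_square)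
    show ?thesis using area_preimage_cross[OF that] w0 unfolding det by simp
  qed
  have equiv_I: "w = 2 \<longleftrightarrow> (\<exists>f. unimodular f \<and> f ` K = (+) (1/2, 1/2) ` ?I)"
  proof
    show "\<exists>f. unimodular f \<and> f ` K = (+) (1/2, 1/2) ` ?I" if "w = 2"
      using main that by (elim conjE) (erule mp)
    show "w = 2" if "\<exists>f. unimodular f \<and> f ` K = (+) (1/2, 1/2) ` ?I"
      using that by (elim exE conjE) (rule revI)
  qed
  have equiv_III: "emeasure lborel K = ennreal (w\<^sup>2 / (2 * (w - 1))) \<longleftrightarrow>
      (\<exists>f. unimodular f \<and> f ` K = (+) (1/2, 1/2) ` ?III)" if w1: "1 < w"
  proof
    assume eq: "emeasure lborel K = ennreal (w\<^sup>2 / (2 * (w - 1)))"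
    have "1 < w \<and> emeasure lborel K = ennreal (w\<^sup>2 / (2 * (w - 1))) \<longrightarrow>
      (\<exists>f. unimodular f \<and> f ` K = (+) (1/2, 1/2) ` ?III)" using main by (elim conjE)
    then show "\<exists>f. unimodular f \<and> f ` K = (+) (1/2, 1/2) ` ?III" using w1 eq by (rule mp[OF _ conjI])
  next
    assume "\<exists>f. unimodular f \<and> f ` K = (+) (1/2, 1/2) ` ?III"
    then show "emeasure lborel K = ennreal (w\<^sup>2 / (2 * (w - 1)))" by (elim exE conjE) (rule revIII[OF w1])
  qed
  have equiv_IV: "emeasure lborel K = ennreal (w\<^sup>2 / 2) \<longleftrightarrow>
      (\<exists>f \<alpha> t. unimodular f \<and> 0 \<le> \<alpha> \<and> \<alpha> < 1 \<and> w \<le> max (1 + \<alpha>) (2 - \<alpha>) \<and> f ` K = (+) t ` ?IV \<alpha>)"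
  proof
    assume eq: "emeasure lborel K = ennreal (w\<^sup>2 / 2)"
    have "emeasure lborel K = ennreal (w\<^sup>2 / 2) \<longrightarrow>
      (\<exists>f \<alpha> t. unimodular f \<and> 0 \<le> \<alpha> \<and> \<alpha> < 1 \<and> w \<le> max (1 + \<alpha>) (2 - \<alpha>) \<and> f ` K = (+) t ` ?IV \<alpha>)"
      using main by (elim conjE)
    then show "\<exists>f \<alpha> t. unimodular f \<and> 0 \<le> \<alpha> \<and> \<alpha> < 1 \<and> w \<le> max (1 + \<alpha>) (2 - \<alpha>) \<and> f ` K = (+) t ` ?IV \<alpha>"
      using eq by (rule mp)
  next
    assume "\<exists>f \<alpha> t. unimodular f \<and> 0 \<le> \<alpha> \<and> \<alpha> < 1 \<and> w \<le> max (1 + \<alpha>) (2 - \<alpha>) \<and> f ` K = (+) t ` ?IV \<alpha>"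
    then show "emeasure lborel K = ennreal (w\<^sup>2 / 2)" by (elim exE conjE) (rule revIV)
  qed
  show ?thesis unfolding area_def eI eIII IV
  proof (intro conjI impI)
    show "0 < lattice_width K" by (rule pos)
    show "lattice_width K \<le> 2" using main by (elim conjE)
    show "emeasure lborel K \<le> ennreal (w\<^sup>2 / (2 * (w - 1)))" if "1 < w \<and> w \<le> 2" using main that by (elim conjE) (erule mp)
    show "ennreal (w\<^sup>2 / 2) \<le> emeasure lborel K" using main by (elim conjE)
    show "w = 2 \<longleftrightarrow> (\<exists>f. unimodular f \<and> f ` K = (+) (1/2, 1/2) ` ?I)" by (rule equiv_I)
    show "emeasure lborel K = \<infinity> \<longleftrightarrow> \<not> bounded K \<and> (\<exists>S. is_split S \<and> K \<subseteq> S)" using main by (elim conjE)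
    show "emeasure lborel K = ennreal (w\<^sup>2 / (2 * (w - 1))) \<longleftrightarrow>
      (\<exists>f. unimodular f \<and> f ` K = (+) (1/2, 1/2) ` ?III)" if "1 < w \<and> w \<le> 2" using that by (intro equiv_III) simp
    show "emeasure lborel K = ennreal (w\<^sup>2 / 2) \<longleftrightarrow>
      (\<exists>f \<alpha> t. unimodular f \<and> 0 \<le> \<alpha> \<and> \<alpha> < 1 \<and> w \<le> max (1 + \<alpha>) (2 - \<alpha>) \<and> f ` K = (+) t ` ?IV \<alpha>)" by (rule equiv_IV)
  qed
qed

end
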